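(* Let $A$ be a closed, densely defined operator on a complex Hilbert space $X$, and assume that for some $c>0$ one has $\|Ax\| \ge c\|x\|$ for all $x\in D(A)$. Let $A = UP$ be the polar decomposition of $A$. Let $\tilde Z$ be the Hilbert space $X \times X$, and let $\tilde B$ be the operator on $\tilde Z$ given by $$\tilde B = \begin{pmatrix} A& c(I-UU^* )\\ 0 & cU^* \end{pmatrix},$$ with domain $D(\tilde B) = D(A) \times X$, i.e. $\tilde B(x_1,x_2) = (Ax_1 + c(I-UU^* )x_2,\ cU^*x_2)$. Then $\tilde B$ has the following properties: (a) $\tilde B$ is an outer extension of $A$ (when $X$ is identified with $X \times \{0\}$). (b) $\tilde B$ is invertible and $\|\tilde B^{-1}\| \le c^{-1}$. (c) If $A$ is not invertible, then $\sigma(\tilde B) \subseteq \sigma(A)$. (d) If $A$ generates a $C_0$-semigroup on $X$, then $\tilde B$ generates a $C_0$-semigroup on $\tilde Z$. (e) If $A$ is bounded, then $\tilde B$ is bounded and $\|\tilde B\|=\|A\|$.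
   Context: Operators are (possibly unbounded) linear maps $A$ from a subspace $D(A)\subseteq X$ into $X$. The polar decomposition is $A=UP$ with $P=(A^*A)^{1/2}$ self-adjoint, $D(P)=D(A)$, and $U$ a partial isometry with initial space the closure of $\operatorname{Ran} P$; under the lower bound on $A$, $P$ is invertible and $U$ is an isometry of $X$ onto the closed subspace $\operatorname{Ran} A$. The norm on $X\times X$ is $\|(x_1,x_2)\|^2=\|x_1\|^2+\|x_2\|^2$. An operator is invertible if it is a bijection of its domain onto the whole space with bounded inverse. An operator $B$ on a space $Y$ containing $X$ as a closed subspace is an outer extension of $A$ if $D(A)=D(B)\cap X$ and $Bx=Ax$ for all $x\in D(A)$. *)

theory Defs
  imports "HOL-Analysis.Analysis"
begin

section \<open>Complex Hilbert spaces\<close>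

text \<open>
  The inner product is linear in the first and conjugate linear in the second argument.
  The last axiom makes the norm and the topology inherited from \<^class>\<open>real_inner\<close>
  those of the complex inner product: \<open>(norm x)\<^sup>2 = inner x x = Re (cinner x x) = cinner x x\<close>.
\<close>

class complex_hilbert_space = real_inner + complete_space +
  fixes scaleC :: "complex \<Rightarrow> 'a \<Rightarrow> 'a"  (infixr \<open>*\<^sub>C\<close> 75)
    and cinner :: "'a \<Rightarrow> 'a \<Rightarrow> complex"
  assumes scaleC_add_right: "a *\<^sub>C (x + y) = a *\<^sub>C x + a *\<^sub>C y"
    and scaleC_add_left: "(a + b) *\<^sub>C x = a *\<^sub>C x + b *\<^sub>C x"
    and scaleC_scaleC: "a *\<^sub>C (b *\<^sub>C x) = (a * b) *\<^sub>C x"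
    and scaleC_of_real: "complex_of_real r *\<^sub>C x = r *\<^sub>R x"
    and cinner_commute: "cinner x y = cnj (cinner y x)"
    and cinner_add_left: "cinner (x + y) z = cinner x z + cinner y z"
    and cinner_scaleC_left: "cinner (a *\<^sub>C x) y = a * cinner x y"
    and Re_cinner: "Re (cinner x y) = inner x y"

text \<open>
  The underlying real inner product on pairs is the one of HOL-Analysis, so that
  \<open>norm (x\<^sub>1, x\<^sub>2) = sqrt ((norm x\<^sub>1)\<^sup>2 + (norm x\<^sub>2)\<^sup>2)\<close>.
\<close>

instantiation prod :: (complex_hilbert_space, complex_hilbert_space) complex_hilbert_space
begin

definition scaleC_prod_def: "a *\<^sub>C x = (a *\<^sub>C fst x, a *\<^sub>C snd x)"

definition cinner_prod_def: "cinner x y = cinner (fst x) (fst y) + cinner (snd x) (snd y)"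

instance
proof
  fix a b :: complex and r :: real and x y z :: "'a \<times> 'b"
  show "a *\<^sub>C (x + y) = a *\<^sub>C x + a *\<^sub>C y"
    by (simp add: scaleC_prod_def scaleC_add_right)
  show "(a + b) *\<^sub>C x = a *\<^sub>C x + b *\<^sub>C x"
    by (simp add: scaleC_prod_def scaleC_add_left)
  show "a *\<^sub>C (b *\<^sub>C x) = (a * b) *\<^sub>C x"
    by (simp add: scaleC_prod_def scaleC_scaleC)
  show "complex_of_real r *\<^sub>C x = r *\<^sub>R x"
    by (simp add: scaleC_prod_def scaleC_of_real scaleR_prod_def)
  show "cinner x y = cnj (cinner y x)"
    by (simp add: cinner_prod_def cinner_commute[of "fst x"] cinner_commute[of "snd x"])
  show "cinner (x + y) z = cinner x z + cinner y z"
    by (simp add: cinner_prod_def cinner_add_left)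
  show "cinner (a *\<^sub>C x) y = a * cinner x y"
    by (simp add: cinner_prod_def scaleC_prod_def cinner_scaleC_left distrib_left)
  show "Re (cinner x y) = inner x y"
    by (simp add: cinner_prod_def Re_cinner inner_prod_def)
qed

end

lemma vector_space_scaleC: "vector_space (scaleC :: complex \<Rightarrow> 'a \<Rightarrow> 'a::complex_hilbert_space)"
proof
  show "1 *\<^sub>C x = x" for x :: 'a
    using scaleC_of_real[of 1 x] by simp
qed (simp_all add: scaleC_add_right scaleC_add_left scaleC_scaleC)

abbreviation clinear :: "('a::complex_hilbert_space \<Rightarrow> 'b::complex_hilbert_space) \<Rightarrow> bool"
  where "clinear \<equiv> Vector_Spaces.linear scaleC scaleC"

abbreviation csubspace :: "'a::complex_hilbert_space set \<Rightarrow> bool"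
  where "csubspace \<equiv> module.subspace scaleC"

section \<open>Unbounded operators\<close>

text \<open>
  An operator from \<open>'a\<close> to \<open>'b\<close> is a partial function whose domain \<^term>\<open>dom A\<close> is \<open>D(A)\<close>. Thus
  \<^term>\<open>ran A\<close> is its range, \<^term>\<open>Map.graph A\<close> its graph, and \<^term>\<open>A \<circ>\<^sub>m B\<close> the
  product \<open>AB\<close> with its natural domain; equality of operators includes equality of domains.
  The value \<open>A \<cdot> x\<close> is meaningful only for \<^prop>\<open>x \<in> dom A\<close>.
\<close>

abbreviation op_apply :: "('a \<rightharpoonup> 'b) \<Rightarrow> 'a \<Rightarrow> 'b"  (infixr \<open>\<cdot>\<close> 80)
  where "A \<cdot> x \<equiv> the (A x)"

definition is_operator :: "('a::complex_hilbert_space \<rightharpoonup> 'b::complex_hilbert_space) \<Rightarrow> bool"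
  where "is_operator A \<longleftrightarrow> csubspace (dom A) \<and>
    (\<forall>x\<in>dom A. \<forall>y\<in>dom A. A \<cdot> (x + y) = A \<cdot> x + A \<cdot> y) \<and>
    (\<forall>a. \<forall>x\<in>dom A. A \<cdot> (a *\<^sub>C x) = a *\<^sub>C (A \<cdot> x))"

definition closed_op :: "('a::complex_hilbert_space \<rightharpoonup> 'b::complex_hilbert_space) \<Rightarrow> bool"
  where "closed_op A \<longleftrightarrow> closed (Map.graph A)"

definition densely_defined :: "('a::complex_hilbert_space \<rightharpoonup> 'b::complex_hilbert_space) \<Rightarrow> bool"
  where "densely_defined A \<longleftrightarrow> closure (dom A) = UNIV"

text \<open>Boundedness is relative to the domain, which need not be the whole space.\<close>

definition bounded_op :: "('a::complex_hilbert_space \<rightharpoonup> 'b::complex_hilbert_space) \<Rightarrow> bool"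
  where "bounded_op A \<longleftrightarrow> (\<exists>K. \<forall>x\<in>dom A. norm (A \<cdot> x) \<le> K * norm x)"

text \<open>Meaningful only for bounded operators; like \<^const>\<open>onorm\<close>, it uses \<open>0 / 0 = 0\<close>.\<close>

definition op_norm :: "('a::complex_hilbert_space \<rightharpoonup> 'b::complex_hilbert_space) \<Rightarrow> real"
  where "op_norm A = (SUP x\<in>dom A. norm (A \<cdot> x) / norm x)"

definition op_inverse :: "('a \<rightharpoonup> 'b) \<Rightarrow> ('b \<rightharpoonup> 'a)"
  where "op_inverse A = (\<lambda>y. if y \<in> ran A then Some (THE x. A x = Some y) else None)"

definition invertible_op :: "('a::complex_hilbert_space \<rightharpoonup> 'b::complex_hilbert_space) \<Rightarrow> bool"
  where "invertible_op A \<longleftrightarrow> bij_betw (\<lambda>x. A \<cdot> x) (dom A) UNIV \<and> bounded_op (op_inverse A)"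

definition op_spectrum :: "('a::complex_hilbert_space \<rightharpoonup> 'a) \<Rightarrow> complex set"
  where "op_spectrum A =
    {\<mu>. \<not> invertible_op (\<lambda>x. map_option (\<lambda>y. y - \<mu> *\<^sub>C x) (A x))}"

text \<open>For densely defined \<open>A\<close>, the vector \<open>z\<close> below is unique.\<close>

definition adj :: "('a::complex_hilbert_space \<rightharpoonup> 'b::complex_hilbert_space) \<Rightarrow> ('b \<rightharpoonup> 'a)"
  where "adj A = (\<lambda>y.
    if \<exists>z. \<forall>x\<in>dom A. cinner (A \<cdot> x) y = cinner x z
    then Some (THE z. \<forall>x\<in>dom A. cinner (A \<cdot> x) y = cinner x z) else None)"

definition selfadjoint_op :: "('a::complex_hilbert_space \<rightharpoonup> 'a) \<Rightarrow> bool"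
  where "selfadjoint_op A \<longleftrightarrow> is_operator A \<and> densely_defined A \<and> adj A = A"

definition positive_op :: "('a::complex_hilbert_space \<rightharpoonup> 'a) \<Rightarrow> bool"
  where "positive_op A \<longleftrightarrow> (\<forall>x\<in>dom A. cinner (A \<cdot> x) x \<in> \<real>\<^sub>\<ge>\<^sub>0)"

text \<open>\<open>S = T\<^bsup>1/2\<^esup>\<close>, the positive self-adjoint square root.\<close>

definition is_positive_sqrt ::
    "('a::complex_hilbert_space \<rightharpoonup> 'a) \<Rightarrow> ('a \<rightharpoonup> 'a) \<Rightarrow> bool"
  where "is_positive_sqrt S T \<longleftrightarrow> selfadjoint_op S \<and> positive_op S \<and> S \<circ>\<^sub>m S = T"

text \<open>The initial space is the orthogonal complement of the kernel.\<close>

definition initial_space :: "('a::complex_hilbert_space \<rightharpoonup> 'b::complex_hilbert_space) \<Rightarrow> 'a set"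
  where "initial_space U = {x. \<forall>k. U k = Some 0 \<longrightarrow> cinner x k = 0}"

definition partial_isometry ::
    "('a::complex_hilbert_space \<rightharpoonup> 'b::complex_hilbert_space) \<Rightarrow> bool"
  where "partial_isometry U \<longleftrightarrow> is_operator U \<and> dom U = UNIV \<and> bounded_op U \<and>
    (\<forall>x\<in>initial_space U. norm (U \<cdot> x) = norm x)"

text \<open>
  \<^prop>\<open>A = U \<circ>\<^sub>m P\<close> contains \<^prop>\<open>dom P = dom A\<close>, because \<open>U\<close> is defined everywhere.
\<close>

definition polar_decomposition :: "('a::complex_hilbert_space \<rightharpoonup> 'b::complex_hilbert_space) \<Rightarrow>
    ('a \<rightharpoonup> 'b) \<Rightarrow> ('a \<rightharpoonup> 'a) \<Rightarrow> bool"
  where "polar_decomposition A U P \<longleftrightarrow>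
    is_positive_sqrt P (adj A \<circ>\<^sub>m A) \<and>
    partial_isometry U \<and> initial_space U = closure (ran P) \<and>
    A = U \<circ>\<^sub>m P"

text \<open>
  \<open>B\<close> is an outer extension of \<open>A\<close> when \<open>'a\<close> is identified with the closed subspace
  \<^term>\<open>range J\<close> of \<open>'b\<close> along the isometric embedding \<open>J\<close>.
\<close>

definition outer_extension :: "('a::complex_hilbert_space \<Rightarrow> 'b::complex_hilbert_space) \<Rightarrow>
    ('b \<rightharpoonup> 'b) \<Rightarrow> ('a \<rightharpoonup> 'a) \<Rightarrow> bool"
  where "outer_extension J B A \<longleftrightarrow>
    clinear J \<and> (\<forall>x. norm (J x) = norm x) \<and> closed (range J) \<and> is_operator B \<and>
    J ` dom A = dom B \<inter> range J \<and> (\<forall>x\<in>dom A. B \<cdot> J x = J (A \<cdot> x))"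

section \<open>Semigroups\<close>

text \<open>Only the values \<open>T t\<close> for \<^prop>\<open>t \<ge> 0\<close> matter.\<close>

definition C0_semigroup :: "(real \<Rightarrow> 'a::complex_hilbert_space \<Rightarrow> 'a) \<Rightarrow> bool"
  where "C0_semigroup T \<longleftrightarrow>
    (\<forall>t\<ge>0. clinear (T t) \<and> bounded_linear (T t)) \<and>
    T 0 = id \<and> (\<forall>s\<ge>0. \<forall>t\<ge>0. T (s + t) = T s \<circ> T t) \<and>
    (\<forall>x. ((\<lambda>t. T t x) \<longlongrightarrow> x) (at_right 0))"

definition semigroup_generator :: "(real \<Rightarrow> 'a::complex_hilbert_space \<Rightarrow> 'a) \<Rightarrow> ('a \<rightharpoonup> 'a)"
  where "semigroup_generator T = (\<lambda>x.
    if \<exists>y. ((\<lambda>t. (T t x - x) /\<^sub>R t) \<longlongrightarrow> y) (at_right 0)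
    then Some (Lim (at_right 0) (\<lambda>t. (T t x - x) /\<^sub>R t)) else None)"

definition generates_C0_semigroup :: "('a::complex_hilbert_space \<rightharpoonup> 'a) \<Rightarrow> bool"
  where "generates_C0_semigroup A \<longleftrightarrow> (\<exists>T. C0_semigroup T \<and> semigroup_generator T = A)"

section \<open>The block operator\<close>

definition block_extension :: "real \<Rightarrow> ('a::complex_hilbert_space \<rightharpoonup> 'a) \<Rightarrow> ('a \<rightharpoonup> 'a) \<Rightarrow>
    ('a \<times> 'a \<rightharpoonup> 'a \<times> 'a)"
  where "block_extension c A U = (\<lambda>(x\<^sub>1, x\<^sub>2).
    if x\<^sub>1 \<in> dom A
    then Some (A \<cdot> x\<^sub>1 + c *\<^sub>R (x\<^sub>2 - (U \<circ>\<^sub>m adj U) \<cdot> x\<^sub>2), c *\<^sub>R (adj U \<cdot> x\<^sub>2))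
    else None)"

end

theory Submission
  imports Defs
begin

text \<open>
  Let \<open>U\<close> be the isometric factor of \<open>A\<close>. The lower bound makes \<open>P\<close> injective, and a self-adjoint
  injective operator has dense range, so the initial space of \<open>U\<close> is everything: \<open>U\<close> is an isometry
  of \<open>X\<close> onto the closed space \<open>Ran A\<close>, and \<open>UU\<^sup>*\<close> is the orthogonal projection onto it
  (\<open>polar_decomposition_isometry\<close>, \<open>isometry_adjoint\<close>). Write \<open>q = c(I - UU\<^sup>*)\<close> and
  \<open>d = cU\<^sup>*\<close> for the second column of the block operator. Everything about norms and inverses
  comes from two facts: \<open>q\<close> maps into the orthogonal complement of \<open>Ran A\<close>, and
  \<open>\<parallel>qx\<parallel>\<^sup>2 + \<parallel>dx\<parallel>\<^sup>2 = c\<^sup>2\<parallel>x\<parallel>\<^sup>2\<close>. Together they give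

  \<open>\<parallel>B(x\<^sub>1, x\<^sub>2)\<parallel>\<^sup>2 = \<parallel>Ax\<^sub>1\<parallel>\<^sup>2 + c\<^sup>2\<parallel>x\<^sub>2\<parallel>\<^sup>2\<close>,

  from which the bound \<open>\<parallel>Bz\<parallel> \<ge> c\<parallel>z\<parallel>\<close> and, for bounded \<open>A\<close>, the equality of norms can be read off;
  here \<open>c \<le> \<parallel>A\<parallel>\<close> unless \<open>X = 0\<close>. The block operator is onto because \<open>q\<close> supplies the
  complement of \<open>Ran A\<close> in the first component while \<open>d\<close> maps \<open>Ran A\<close> onto \<open>X\<close> and annihilates
  that complement.

  For the spectrum, suppose that \<open>A\<close> is not invertible. Then the closed disc of radius \<open>c\<close> lies in
  the spectrum of \<open>A\<close> (\<open>invertible_if_op_shift_invertible\<close>). If \<open>\<mu>\<close> is in the resolvent set of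
  \<open>A\<close>, therefore \<open>\<bar>\<mu>\<bar> > c \<ge> \<parallel>d\<parallel>\<close>, so \<open>d - \<mu>\<close> is invertible, and a triangular operator with
  invertible diagonal is invertible.

  For semigroups only the triangular shape matters. If \<open>A\<close> generates \<open>S\<close>, and \<open>E(t) = exp(td)\<close>, then
  variation of constants gives the semigroup

  \<open>(x\<^sub>1, x\<^sub>2) \<mapsto> (S(t)x\<^sub>1 + \<integral>\<^sub>0\<^sup>t S(t - s) q E(s)x\<^sub>2 ds, E(t)x\<^sub>2)\<close>.

  The derivative of the integral at \<open>0\<close> exists for every \<open>x\<^sub>2\<close> and equals \<open>qx\<^sub>2\<close>, so the generator
  is the block operator with exactly the domain \<open>D(A) \<times> X\<close>
  (\<open>generates_C0_semigroup_triangular_op\<close>).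
\<close>


section \<open>Hilbert space geometry\<close>

instance complex_hilbert_space \<subseteq> banach ..

lemma clinear_iff:
  fixes f :: "'a::complex_hilbert_space \<Rightarrow> 'b::complex_hilbert_space"
  shows "clinear f \<longleftrightarrow> (\<forall>x y. f (x + y) = f x + f y) \<and> (\<forall>a x. f (a *\<^sub>C x) = a *\<^sub>C f x)"
  by (simp add: Vector_Spaces.linear_iff vector_space_scaleC)

lemma csubspace_iff:
  fixes S :: "'a::complex_hilbert_space set"
  shows "csubspace S \<longleftrightarrow> 0 \<in> S \<and> (\<forall>x\<in>S. \<forall>y\<in>S. x + y \<in> S) \<and> (\<forall>a. \<forall>x\<in>S. a *\<^sub>C x \<in> S)"
proof -
  interpret vector_space "scaleC :: complex \<Rightarrow> 'a \<Rightarrow> 'a"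
    by (rule vector_space_scaleC)
  show ?thesis
    by (rule subspace_def)
qed

lemma clinear_imp_linear:
  assumes "clinear f"
  shows "linear f"
  using assms by (simp add: clinear_iff Real_Vector_Spaces.linear_iff flip: scaleC_of_real)

lemma csubspace_imp_subspace:
  assumes "csubspace S"
  shows "subspace S"
  using assms by (auto simp: csubspace_iff Real_Vector_Spaces.subspace_def simp flip: scaleC_of_real)

lemma cinner_scaleC_right: "cinner x (a *\<^sub>C y) = cnj a * cinner x y"
  by (metis cinner_commute cinner_scaleC_left complex_cnj_cnj complex_cnj_mult)

lemma cinner_add_right: "cinner x (y + z) = cinner x y + cinner x z"
  by (metis cinner_commute cinner_add_left complex_cnj_add)

lemma cinner_diff_right: "cinner x (y - z) = cinner x y - cinner x z"
  by (metis add_diff_cancel cinner_add_right diff_add_cancel)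

lemma cinner_zero_right: "cinner x 0 = 0"
  using cinner_diff_right[of x 0 0] by simp

lemma scaleC_minus_one: "(-1) *\<^sub>C x = - x"
  by (metis of_real_1 of_real_minus scaleC_of_real scaleR_minus1_left)

lemma scaleC_zero_right: "a *\<^sub>C 0 = 0"
  by (metis add_cancel_right_right scaleC_add_right)

lemma scaleC_diff_right: "a *\<^sub>C (x - y) = a *\<^sub>C x - a *\<^sub>C y"
  by (metis add_diff_cancel diff_add_cancel scaleC_add_right)

lemma scaleC_scaleR_commute: "a *\<^sub>C (r *\<^sub>R x) = r *\<^sub>R (a *\<^sub>C x)"
  by (simp add: scaleC_scaleC mult.commute flip: scaleC_of_real)

lemma cinner_self: "cinner x x = complex_of_real ((norm x)\<^sup>2)"
proof (rule complex_eqI)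
  show "Re (cinner x x) = Re (complex_of_real ((norm x)\<^sup>2))"
    by (simp add: Re_cinner power2_norm_eq_inner)
  have "cinner x x = cnj (cinner x x)"
    by (rule cinner_commute)
  then show "Im (cinner x x) = Im (complex_of_real ((norm x)\<^sup>2))"
    by (metis Im_complex_of_real Reals_cnj_iff complex_is_Real_iff)
qed

lemma norm_scaleC: "norm (a *\<^sub>C x) = cmod a * norm x"
proof -
  have "complex_of_real ((norm (a *\<^sub>C x))\<^sup>2) = (a * cnj a) * cinner x x"
    by (simp only: cinner_self[symmetric] cinner_scaleC_left cinner_scaleC_right ac_simps)
  also have "\<dots> = complex_of_real ((cmod a * norm x)\<^sup>2)"
    by (simp add: complex_mult_cnj cinner_self cmod_power2 power_mult_distrib)
  finally have "(norm (a *\<^sub>C x))\<^sup>2 = (cmod a * norm x)\<^sup>2"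
    by (simp only: of_real_eq_iff)
  then show ?thesis
    by (rule power2_eq_imp_eq) auto
qed

lemma bounded_linear_scaleC: "bounded_linear (\<lambda>x. a *\<^sub>C x)"
  by (rule bounded_linear_intro[of _ "cmod a"])
    (auto simp: scaleC_add_right scaleC_scaleR_commute norm_scaleC)

lemma csubspace_closure:
  fixes S :: "'a::complex_hilbert_space set"
  assumes "csubspace S"
  shows "csubspace (closure S)"
  unfolding csubspace_iff
proof (intro conjI ballI allI)
  show "0 \<in> closure S"
    using assms closure_subset by (auto simp: csubspace_iff)
  show "x + y \<in> closure S" if "x \<in> closure S" "y \<in> closure S" for x y
  proof -
    obtain s t where "\<And>n. s n \<in> S" "s \<longlonglongrightarrow> x" "\<And>n. t n \<in> S" "t \<longlonglongrightarrow> y"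
      using \<open>x \<in> closure S\<close> \<open>y \<in> closure S\<close> by (auto simp: closure_sequential)
    then show ?thesis
      using assms unfolding closure_sequential
      by (intro exI[of _ "\<lambda>n. s n + t n"]) (auto simp: csubspace_iff intro: tendsto_add)
  qed
  show "a *\<^sub>C x \<in> closure S" if "x \<in> closure S" for a x
  proof -
    obtain s where "\<And>n. s n \<in> S" "s \<longlonglongrightarrow> x"
      using \<open>x \<in> closure S\<close> by (auto simp: closure_sequential)
    then show ?thesis
      using assms unfolding closure_sequential
      by (intro exI[of _ "\<lambda>n. a *\<^sub>C s n"])
        (auto simp: csubspace_iff intro: bounded_linear.tendsto[OF bounded_linear_scaleC])
  qed
qed

text \<open>
  The complex inner product is determined by the real one, which is how statements about real
  Hilbert spaces are transferred.
\<close>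

lemma cinner_eq_Complex_inner: "cinner x y = Complex (inner x y) (inner (- (\<i> *\<^sub>C x)) y)"
proof (rule complex_eqI)
  have "inner (- (\<i> *\<^sub>C x)) y = Re (- \<i> * cinner x y)"
    by (metis Re_cinner cinner_scaleC_left inner_minus_left mult_minus_left uminus_complex.sel(1))
  then show "Im (cinner x y) = Im (Complex (inner x y) (inner (- (\<i> *\<^sub>C x)) y))"
    by simp
qed (simp add: Re_cinner)

text \<open>
  Polarization.
\<close>

lemma isometry_preserves_cinner:
  assumes "clinear f" and "\<And>x. norm (f x) = norm x"
  shows "cinner (f x) (f y) = cinner x y"
proof -
  have inner: "inner (f x) (f y) = inner x y" for x y
    using assms by (simp add: dot_norm clinear_iff flip: assms(1)[unfolded clinear_iff, THEN conjunct1, rule_format])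
  have "- (\<i> *\<^sub>C f x) = f (- (\<i> *\<^sub>C x))"
    using assms(1) by (simp add: clinear_iff flip: scaleC_minus_one)
  then show ?thesis
    by (simp add: cinner_eq_Complex_inner inner)
qed

text \<open>
  The nearest point exists without any compactness: the parallelogram law makes every minimising
  sequence a Cauchy sequence. At the nearest point \<open>p\<close>, moving by a multiple of \<open>m\<close> cannot
  decrease the distance to \<open>x\<close>, which forces \<open>x - p\<close> to be orthogonal to \<open>m\<close>.
\<close>

lemma orthogonal_projection_exists:
  fixes S :: "'a::{real_inner, complete_space} set"
  assumes "subspace S" and "closed S"
  obtains p where "p \<in> S" and "\<And>m. m \<in> S \<Longrightarrow> inner (x - p) m = 0"
proof -
  define d where "d = infdist x S"
  have "S \<noteq> {}"
    using assms(1) subspace_0 by blast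
  have d_le: "d \<le> norm (x - y)" if "y \<in> S" for y
    unfolding d_def dist_norm[symmetric] by (rule infdist_le[OF that])
  have "\<exists>y\<in>S. norm (x - y) < d + inverse (real (Suc n))" for n
  proof -
    have "infdist x S < d + inverse (real (Suc n))"
      by (simp add: d_def)
    then show ?thesis
      unfolding infdist_notempty[OF \<open>S \<noteq> {}\<close>] dist_norm
      by (subst (asm) cINF_less_iff) (use \<open>S \<noteq> {}\<close> in \<open>auto intro!: bdd_belowI2[of _ 0]\<close>)
  qed
  then obtain y where yS: "\<And>n. y n \<in> S" and y: "\<And>n. norm (x - y n) < d + inverse (real (Suc n))"
    by metis
  have y_lim: "(\<lambda>n. norm (x - y n)) \<longlonglongrightarrow> d"
  proof (rule tendsto_sandwich[where f = "\<lambda>_. d" and h = "\<lambda>n. d + inverse (real (Suc n))"])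
    show "(\<lambda>n. d + inverse (real (Suc n))) \<longlonglongrightarrow> d"
      using tendsto_add[OF tendsto_const LIMSEQ_inverse_real_of_nat] by simp
    show "\<forall>\<^sub>F n in sequentially. norm (x - y n) \<le> d + inverse (real (Suc n))"
      by (rule always_eventually) (use y in \<open>auto simp: less_imp_le\<close>)
  qed (use d_le yS in auto)
  have parallelogram: "(norm (y m - y n))\<^sup>2 \<le> 2 * ((norm (x - y m))\<^sup>2 - d\<^sup>2) + 2 * ((norm (x - y n))\<^sup>2 - d\<^sup>2)" for m n
  proof -
    have "(1 / 2) *\<^sub>R (y m + y n) \<in> S"
      using assms(1) yS by (simp add: subspace_add subspace_scale)
    then have "d\<^sup>2 \<le> (norm (x - (1 / 2) *\<^sub>R (y m + y n)))\<^sup>2"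
      using d_le by (intro power_mono) (auto simp: d_def infdist_nonneg)
    moreover have "4 * (norm (x - (1 / 2) *\<^sub>R (y m + y n)))\<^sup>2 =
        2 * (norm (x - y m))\<^sup>2 + 2 * (norm (x - y n))\<^sup>2 - (norm (y m - y n))\<^sup>2"
      by (simp add: power2_norm_eq_inner inner_diff_left inner_diff_right inner_add_left inner_add_right
          inner_commute algebra_simps)
    ultimately show ?thesis
      by argo
  qed
  have "Cauchy y"
  proof (rule metric_CauchyI)
    fix e :: real
    assume "e > 0"
    have "(\<lambda>n. (norm (x - y n))\<^sup>2 - d\<^sup>2) \<longlonglongrightarrow> d\<^sup>2 - d\<^sup>2"
      by (intro tendsto_intros y_lim)
    then have "eventually (\<lambda>n. (norm (x - y n))\<^sup>2 - d\<^sup>2 < e\<^sup>2 / 4) sequentially"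
      using \<open>e > 0\<close> by (intro order_tendstoD(2)) auto
    then obtain N where N: "\<And>n. n \<ge> N \<Longrightarrow> (norm (x - y n))\<^sup>2 - d\<^sup>2 < e\<^sup>2 / 4"
      by (auto simp: eventually_sequentially)
    have "dist (y m) (y n) < e" if "m \<ge> N" "n \<ge> N" for m n
    proof -
      have "(norm (y m - y n))\<^sup>2 < e\<^sup>2"
        using parallelogram[of m n] N[OF that(1)] N[OF that(2)] by argo
      then show ?thesis
        using \<open>e > 0\<close> by (metis dist_norm less_imp_le power2_less_imp_less)
    qed
    then show "\<exists>M. \<forall>m\<ge>M. \<forall>n\<ge>M. dist (y m) (y n) < e"
      by blast
  qed
  then obtain p where p: "y \<longlonglongrightarrow> p"
    using Cauchy_convergent convergent_def by blast
  have "p \<in> S"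
    using closed_sequentially[OF assms(2)] yS p by blast
  have "norm (x - p) = d"
    using LIMSEQ_unique[OF y_lim tendsto_norm[OF tendsto_diff[OF tendsto_const p]]] by simp
  have "inner (x - p) m = 0" if "m \<in> S" for m
  proof (cases "m = 0")
    case False
    \<comment> \<open>the minimiser of \<open>\<parallel>x - (p + tm)\<parallel>\<close> over real \<open>t\<close>\<close>
    define t where "t = inner (x - p) m / inner m m"
    have "p + t *\<^sub>R m \<in> S"
      using assms(1) \<open>p \<in> S\<close> that by (simp add: subspace_add subspace_scale)
    then have "(norm (x - p))\<^sup>2 \<le> (norm (x - (p + t *\<^sub>R m)))\<^sup>2"
      using d_le \<open>norm (x - p) = d\<close> by (intro power_mono) auto
    also have "\<dots> = (norm (x - p))\<^sup>2 - 2 * t * inner (x - p) m + t * (t * inner m m)"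
      by (simp add: power2_norm_eq_inner inner_diff_left inner_diff_right inner_add_left inner_add_right
          inner_commute algebra_simps)
    also have "t * inner m m = inner (x - p) m"
      using False by (simp add: t_def)
    finally have "t * inner (x - p) m \<le> 0"
      by simp
    then have "(inner (x - p) m)\<^sup>2 / inner m m \<le> 0"
      by (simp add: t_def power2_eq_square)
    then show ?thesis
      using False by (auto simp: divide_le_0_iff dest: inner_gt_zero_iff[THEN iffD2])
  qed auto
  with \<open>p \<in> S\<close> show ?thesis
    using that by blast
qed

lemma complex_orthogonal_projection_exists:
  fixes S :: "'a::complex_hilbert_space set"
  assumes "csubspace S" and "closed S"
  obtains p where "p \<in> S" and "\<And>m. m \<in> S \<Longrightarrow> cinner m (x - p) = 0"
proof -
  obtain p where p: "p \<in> S" "\<And>m. m \<in> S \<Longrightarrow> inner (x - p) m = 0"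
    using orthogonal_projection_exists[OF csubspace_imp_subspace[OF assms(1)] assms(2)] by blast
  have "cinner m (x - p) = 0" if "m \<in> S" for m
  proof -
    have "- (\<i> *\<^sub>C m) \<in> S"
      using assms(1) that by (simp add: csubspace_iff flip: scaleC_minus_one)
    then show ?thesis
      using p(2) that
      by (metis cinner_eq_Complex_inner inner_commute zero_complex.code)
  qed
  with p(1) show ?thesis
    using that by blast
qed

section \<open>The principle of uniform boundedness\<close>

text \<open>
  By Baire's theorem one of the closed sets where all \<open>f \<in> F\<close> are bounded by \<open>n\<close> contains a ball.
  Any vector is, after scaling, the difference of two points of that ball, one of them the centre.
\<close>

lemma uniform_boundedness:
  fixes F :: "('a::banach \<Rightarrow> 'b::real_normed_vector) set"
  assumes lin: "\<And>f. f \<in> F \<Longrightarrow> bounded_linear f"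
    and pointwise: "\<And>x. \<exists>K. \<forall>f\<in>F. norm (f x) \<le> K"
  obtains K where "K \<ge> 0" and "\<And>f x. f \<in> F \<Longrightarrow> norm (f x) \<le> K * norm x"
proof -
  define C where "C n = {x. \<forall>f\<in>F. norm (f x) \<le> real n}" for n
  have "closed (C n)" for n
  proof -
    have "C n = (\<Inter>f\<in>F. {x. norm (f x) \<le> real n})"
      by (auto simp: C_def)
    then show ?thesis
      using lin by (auto intro!: closed_INT closed_Collect_le continuous_intros
          bounded_linear.continuous_on[OF lin continuous_on_id])
  qed
  have "(\<Union>n. C n) = UNIV"
  proof -
    have "\<exists>n. x \<in> C n" for x
    proof -
      obtain K where "\<forall>f\<in>F. norm (f x) \<le> K"
        using pointwise by blast
      moreover obtain n where "K \<le> real n"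
        using real_arch_simple by blast
      ultimately show ?thesis
        by (auto simp: C_def intro!: exI[of _ n] intro: order_trans)
    qed
    then show ?thesis
      by auto
  qed
  have "\<exists>n. interior (C n) \<noteq> {}"
  proof (rule ccontr)
    assume "\<not> ?thesis"
    then have "euclidean interior_of \<Union>(range C) = {}"
      using \<open>\<And>n. closed (C n)\<close>
      by (intro Baire_category_alt) (auto simp: completely_metrizable_space_euclidean)
    then show False
      using \<open>(\<Union>n. C n) = UNIV\<close> by simp
  qed
  then obtain n x0 where "x0 \<in> interior (C n)"
    by blast
  then obtain e where e: "e > 0" "cball x0 e \<subseteq> C n"
    by (meson interior_subset mem_interior_cball)
  have bound: "norm (f x) \<le> (2 * real n / e) * norm x" if f: "f \<in> F" for f x
  proof (cases "x = 0")
    case True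
    then show ?thesis
      using linear_simps(3)[OF lin[OF f]] by simp
  next
    case False
    interpret bounded_linear f
      by (rule lin[OF f])
    define h where "h = (e / norm x) *\<^sub>R x"
    have "norm h = e"
      using e(1) False by (simp add: h_def)
    then have "norm (f (x0 + h)) \<le> real n" "norm (f x0) \<le> real n"
      using e f by (auto simp: C_def subset_eq dist_norm)
    moreover have "f h = f (x0 + h) - f x0"
      by (simp add: add)
    ultimately have "norm (f h) \<le> 2 * real n"
      using norm_triangle_ineq4[of "f (x0 + h)" "f x0"] by simp
    then have "(e / norm x) * norm (f x) \<le> 2 * real n"
      using e(1) by (simp add: h_def scaleR)
    then show ?thesis
      using e(1) False by (simp add: field_simps)
  qed
  show ?thesis
    by (rule that[of "2 * real n / e"]) (use e bound in auto)
qed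


section \<open>Operators bounded below\<close>

lemma dom_iff_apply: "x \<in> dom A \<longleftrightarrow> A x = Some (A \<cdot> x)"
  by (auto simp: dom_def)

lemma mem_ran_iff: "y \<in> ran A \<longleftrightarrow> (\<exists>x\<in>dom A. y = A \<cdot> x)"
  by (force simp: ran_def dom_def)

lemma mem_graph_iff: "(x, y) \<in> Map.graph A \<longleftrightarrow> x \<in> dom A \<and> y = A \<cdot> x"
  by (force simp: Map.graph_def dom_def)

lemma is_operator_diff:
  assumes "is_operator A" and "x \<in> dom A" and "y \<in> dom A"
  shows "x - y \<in> dom A" and "A \<cdot> (x - y) = A \<cdot> x - A \<cdot> y"
proof -
  have "- y \<in> dom A" "A \<cdot> (- y) = - (A \<cdot> y)"
    using assms by (auto simp: is_operator_def csubspace_iff simp flip: scaleC_minus_one)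
  then show "x - y \<in> dom A" and "A \<cdot> (x - y) = A \<cdot> x - A \<cdot> y"
    using assms unfolding is_operator_def csubspace_iff by (metis add_uminus_conv_diff)+
qed

lemma csubspace_ran:
  assumes "is_operator A"
  shows "csubspace (ran A)"
  unfolding csubspace_iff
proof (intro conjI ballI allI)
  have "0 \<in> dom A" "A \<cdot> 0 = 0"
    using assms is_operator_diff[OF assms, of 0 0] by (auto simp: is_operator_def csubspace_iff)
  then show "0 \<in> ran A"
    by (auto simp: mem_ran_iff)
  show "x + y \<in> ran A" if "x \<in> ran A" "y \<in> ran A" for x y
    using assms that unfolding is_operator_def csubspace_iff mem_ran_iff by metis
  show "a *\<^sub>C x \<in> ran A" if "x \<in> ran A" for a x
    using assms that unfolding is_operator_def csubspace_iff mem_ran_iff by metis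
qed

lemma invertible_opI:
  assumes surj: "\<And>y. \<exists>x\<in>dom A. A \<cdot> x = y"
    and "is_operator A" and "k > 0" and below: "\<And>x. x \<in> dom A \<Longrightarrow> k * norm x \<le> norm (A \<cdot> x)"
  shows "invertible_op A" and "op_norm (op_inverse A) \<le> inverse k"
proof -
  have inj: "x = y" if "x \<in> dom A" "y \<in> dom A" "A \<cdot> x = A \<cdot> y" for x y
    using below[OF is_operator_diff(1)[OF assms(2) that(1,2)]] \<open>k > 0\<close> that(3)
    by (simp add: is_operator_diff(2)[OF assms(2) that(1,2)] mult_le_0_iff)
  have dom: "dom (op_inverse A) = UNIV"
    using surj by (auto simp: op_inverse_def dom_def ran_def) (metis domD option.sel)
  have inverse: "op_inverse A \<cdot> y \<in> dom A \<and> A \<cdot> (op_inverse A \<cdot> y) = y" for y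
  proof -
    obtain x where x: "x \<in> dom A" "A \<cdot> x = y"
      using surj by blast
    then have "(THE x. A x = Some y) = x"
      using inj by (intro the_equality) (auto simp: dom_iff_apply)
    moreover have "y \<in> ran A"
      using x by (auto simp: mem_ran_iff)
    ultimately show ?thesis
      using x by (simp add: op_inverse_def)
  qed
  have bound: "norm (op_inverse A \<cdot> y) \<le> inverse k * norm y" for y
    using below[of "op_inverse A \<cdot> y"] inverse[of y] \<open>k > 0\<close> by (simp add: field_simps)
  have "bij_betw (\<lambda>x. A \<cdot> x) (dom A) UNIV"
    using inverse inj by (intro bij_betw_byWitness[where f' = "\<lambda>y. op_inverse A \<cdot> y"]) auto
  moreover have "bounded_op (op_inverse A)"
    using bound unfolding bounded_op_def by blast
  ultimately show "invertible_op A"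
    by (simp add: invertible_op_def)
  show "op_norm (op_inverse A) \<le> inverse k"
    unfolding op_norm_def dom
  proof (rule cSUP_least)
    show "norm (op_inverse A \<cdot> y) / norm y \<le> inverse k" for y
      using bound[of y] \<open>k > 0\<close> by (cases "y = 0") (auto simp: pos_divide_le_eq)
  qed simp
qed

text \<open>
  The bound is taken with a positive constant, so that it can be divided by.
\<close>

lemma invertible_opE:
  assumes "invertible_op A"
  obtains K where "K > 0" and "\<And>x. x \<in> dom A \<Longrightarrow> norm x \<le> K * norm (A \<cdot> x)"
    and "\<And>y. \<exists>x\<in>dom A. A \<cdot> x = y"
proof -
  obtain K where K: "\<And>y. y \<in> dom (op_inverse A) \<Longrightarrow> norm (op_inverse A \<cdot> y) \<le> K * norm y"
    using assms by (auto simp: invertible_op_def bounded_op_def)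
  have inj: "x = y" if "x \<in> dom A" "y \<in> dom A" "A \<cdot> x = A \<cdot> y" for x y
    using assms that by (auto simp: invertible_op_def bij_betw_def inj_on_def)
  have bound: "norm x \<le> max K 1 * norm (A \<cdot> x)" if "x \<in> dom A" for x
  proof -
    have "(THE x'. A x' = Some (A \<cdot> x)) = x"
    proof (rule the_equality)
      show "A x = Some (A \<cdot> x)"
        using that by (simp add: dom_iff_apply)
      show "x' = x" if "A x' = Some (A \<cdot> x)" for x'
        using inj[of x' x] that \<open>x \<in> dom A\<close> by auto
    qed
    moreover have "A \<cdot> x \<in> ran A"
      using that by (auto simp: mem_ran_iff)
    ultimately have "op_inverse A (A \<cdot> x) = Some x"
      by (simp add: op_inverse_def)
    then have "norm x \<le> K * norm (A \<cdot> x)"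
      using K[of "A \<cdot> x"] by (simp add: domI)
    also have "\<dots> \<le> max K 1 * norm (A \<cdot> x)"
      by (intro mult_right_mono) auto
    finally show ?thesis .
  qed
  have "\<exists>x\<in>dom A. A \<cdot> x = y" for y
    using assms by (auto simp: invertible_op_def bij_betw_def image_iff) (metis UNIV_I image_iff)
  with bound show ?thesis
    using that[of "max K 1"] by auto
qed

text \<open>
  The lower bound turns a convergent sequence in the range into a convergent sequence of
  preimages, and the closed graph puts the limit in the range.
\<close>

lemma closed_ran_if_bounded_below:
  assumes "is_operator A" and "closed_op A" and "c > 0"
    and below: "\<And>x. x \<in> dom A \<Longrightarrow> c * norm x \<le> norm (A \<cdot> x)"
  shows "closed (ran A)"
  unfolding closed_sequential_limits
proof (intro allI impI, elim conjE)
  fix s l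
  assume "\<forall>n. s n \<in> ran A" and l: "s \<longlonglongrightarrow> l"
  then have "\<forall>n. \<exists>x\<in>dom A. s n = A \<cdot> x"
    by (simp add: mem_ran_iff)
  then obtain x where x: "\<And>n. x n \<in> dom A" "\<And>n. s n = A \<cdot> x n"
    by metis
  have dist: "c * dist (x m) (x n) \<le> dist (s m) (s n)" for m n
    using below[OF is_operator_diff(1)[OF assms(1) x(1) x(1)]]
    by (simp add: dist_norm x(2) is_operator_diff(2)[OF assms(1) x(1) x(1)])
  have "Cauchy x"
  proof (rule metric_CauchyI)
    fix e :: real
    assume "e > 0"
    then obtain N where "\<And>m n. m \<ge> N \<Longrightarrow> n \<ge> N \<Longrightarrow> dist (s m) (s n) < c * e"
      using LIMSEQ_imp_Cauchy[OF l] \<open>c > 0\<close> unfolding Cauchy_def by (metis mult_pos_pos)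
    then show "\<exists>M. \<forall>m\<ge>M. \<forall>n\<ge>M. dist (x m) (x n) < e"
      using dist \<open>c > 0\<close> by (meson le_less_trans mult_less_cancel_left_pos)
  qed
  then obtain z where "x \<longlonglongrightarrow> z"
    using Cauchy_convergent convergent_def by blast
  then have "(\<lambda>n. (x n, s n)) \<longlonglongrightarrow> (z, l)"
    using l by (rule tendsto_Pair)
  moreover have "(x n, s n) \<in> Map.graph A" for n
    using x by (simp add: mem_graph_iff)
  ultimately have "(z, l) \<in> Map.graph A"
    using assms(2) closed_sequentially[of "Map.graph A" "\<lambda>n. (x n, s n)"] unfolding closed_op_def by simp
  then show "l \<in> ran A"
    by (auto simp: mem_graph_iff mem_ran_iff)
qed

section \<open>The isometric factor of the polar decomposition\<close>

text \<open>
  A vector orthogonal to the range of \<open>P\<close> belongs to the kernel of \<open>P\<^sup>* = P\<close>.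
\<close>

lemma dense_ran_if_selfadjoint_injective:
  fixes P :: "'a::complex_hilbert_space \<rightharpoonup> 'a"
  assumes "selfadjoint_op P" and inj: "\<And>x. P x = Some 0 \<Longrightarrow> x = 0"
  shows "closure (ran P) = UNIV"
proof -
  have op: "is_operator P" and dense: "closure (dom P) = UNIV" and adj: "adj P = P"
    using assms(1) by (auto simp: selfadjoint_op_def densely_defined_def)
  have "csubspace (closure (ran P))"
    by (rule csubspace_closure[OF csubspace_ran[OF op]])
  moreover have "closed (closure (ran P))"
    by simp
  ultimately have proj: "\<exists>p\<in>closure (ran P). \<forall>m\<in>closure (ran P). cinner m (x - p) = 0" for x
    using complex_orthogonal_projection_exists by metis
  have "x \<in> closure (ran P)" for x
  proof -
    obtain p where p: "p \<in> closure (ran P)" "\<And>m. m \<in> closure (ran P) \<Longrightarrow> cinner m (x - p) = 0"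
      using proj by blast
    have ortho: "\<forall>z\<in>dom P. cinner (P \<cdot> z) (x - p) = cinner z 0"
    proof
      fix z
      assume "z \<in> dom P"
      then have "P \<cdot> z \<in> closure (ran P)"
        using closure_subset by (force simp: mem_ran_iff)
      then show "cinner (P \<cdot> z) (x - p) = cinner z 0"
        using p(2) by (simp add: cinner_zero_right)
    qed
    \<comment> \<open>the value of the adjoint is unique because \<open>P\<close> is densely defined\<close>
    have "(THE w. \<forall>z\<in>dom P. cinner (P \<cdot> z) (x - p) = cinner z w) = 0"
    proof (rule the_equality)
      fix w
      assume w: "\<forall>z\<in>dom P. cinner (P \<cdot> z) (x - p) = cinner z w"
      have "dom P \<subseteq> {z. inner z w = 0}"
      proof
        fix z
        assume "z \<in> dom P"
        then have "cinner z w = cinner z 0"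
          using w ortho by metis
        then have "inner z w = inner z 0"
          by (metis Re_cinner)
        then show "z \<in> {z. inner z w = 0}"
          by simp
      qed
      moreover have "closed {z. inner z w = 0}"
        by (intro closed_Collect_eq continuous_intros)
      ultimately have "closure (dom P) \<subseteq> {z. inner z w = 0}"
        by (rule closure_minimal)
      then have "inner w w = 0"
        using dense by blast
      then show "w = 0"
        by simp
    qed (use ortho in blast)
    then have "adj P (x - p) = Some 0"
      using ortho by (auto simp: adj_def)
    then have "x - p = 0"
      using inj[of "x - p"] adj by metis
    then have "x = p"
      by simp
    with p(1) show ?thesis
      by simp
  qed
  then show ?thesis
    by auto
qed

text \<open>
  As \<open>\<parallel>Ax\<parallel> \<ge> c\<parallel>x\<parallel>\<close> and \<open>A = UP\<close>, the operator \<open>P\<close> is injective, so its range is dense and \<open>U\<close> is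
  isometric on the whole space. By continuity \<open>U\<close> maps the closure of the range of \<open>P\<close>, that is
  everything, into the closure of the range of \<open>A\<close>, which is already closed.
\<close>

lemma polar_decomposition_isometry:
  fixes A U P :: "'a::complex_hilbert_space \<rightharpoonup> 'a"
  assumes "is_operator A" and "closed_op A" and "c > 0"
    and below: "\<And>x. x \<in> dom A \<Longrightarrow> c * norm x \<le> norm (A \<cdot> x)"
    and polar: "polar_decomposition A U P"
  shows "dom U = UNIV" and "clinear (\<lambda>x. U \<cdot> x)" and "norm (U \<cdot> x) = norm x" and "ran U = ran A"
proof -
  have P: "selfadjoint_op P" and U: "partial_isometry U" and initial: "initial_space U = closure (ran P)"
    and A: "A = U \<circ>\<^sub>m P"
    using polar by (auto simp: polar_decomposition_def is_positive_sqrt_def)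
  show dom: "dom U = UNIV"
    using U by (simp add: partial_isometry_def)
  then have "\<forall>x. \<exists>y. U x = Some y"
    by blast
  then obtain u where U_Some: "\<And>x. U x = Some (u x)"
    by metis
  show lin: "clinear (\<lambda>x. U \<cdot> x)"
    using U dom by (simp add: partial_isometry_def is_operator_def clinear_iff)
  then have lin_u: "linear u"
    by (simp add: U_Some clinear_imp_linear)
  have "x = 0" if "P x = Some 0" for x
  proof -
    have "x \<in> dom A" "A \<cdot> x = 0"
      using that by (auto simp: A map_comp_def U_Some linear_0[OF lin_u])
    then show "x = 0"
      using below[of x] \<open>c > 0\<close> by (simp add: mult_le_0_iff)
  qed
  then have dense: "closure (ran P) = UNIV"
    by (rule dense_ran_if_selfadjoint_injective[OF P])
  then have isometry: "norm (U \<cdot> x) = norm x" for x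
    using U initial by (auto simp: partial_isometry_def)
  then show "norm (U \<cdot> x) = norm x" .
  have ran_A: "ran A = u ` ran P"
    by (force simp: A ran_def map_comp_def U_Some split: option.splits)
  have ran_U: "ran U = range u"
    by (force simp: ran_def U_Some)
  have "bounded_linear u"
    using isometry linear_add[OF lin_u] linear_scale[OF lin_u]
    by (intro bounded_linear_intro[of _ 1]) (auto simp: U_Some)
  then have "u ` closure (ran P) \<subseteq> closure (ran A)"
    unfolding ran_A by (rule closure_bounded_linear_image_subset)
  moreover have "closure (ran A) = ran A"
    using closed_ran_if_bounded_below[OF assms(1-3) below] by simp
  ultimately show "ran U = ran A"
    using ran_A by (auto simp: dense ran_U)
qed

text \<open>
  If \<open>p = Uz\<close> is the orthogonal projection of \<open>y\<close> onto the range of \<open>U\<close>, then \<open>U\<^sup>*y = z\<close>. The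
  last identity is Pythagoras for \<open>y = (y - UU\<^sup>*y) + UU\<^sup>*y\<close>.
\<close>

lemma isometry_adjoint:
  fixes U :: "'a::complex_hilbert_space \<rightharpoonup> 'b::complex_hilbert_space"
  assumes dom: "dom U = UNIV" and lin: "clinear (\<lambda>x. U \<cdot> x)" and isometry: "\<And>x. norm (U \<cdot> x) = norm x"
    and closed: "closed (ran U)"
  shows "dom (adj U) = UNIV" and "clinear (\<lambda>y. adj U \<cdot> y)"
    and "cinner (U \<cdot> x) y = cinner x (adj U \<cdot> y)" and "adj U \<cdot> (U \<cdot> x) = x"
    and "(norm y)\<^sup>2 = (norm (y - U \<cdot> adj U \<cdot> y))\<^sup>2 + (norm (adj U \<cdot> y))\<^sup>2"
proof -
  have "is_operator U"
    using dom lin by (simp add: is_operator_def clinear_iff csubspace_iff)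
  have unique: "z = z'" if "\<And>x. cinner x z = cinner x z'" for z z' :: 'a
  proof -
    have "inner (z - z') (z - z') = 0"
      using that[of "z - z'"] by (simp flip: Re_cinner add: cinner_diff_right)
    then show ?thesis
      by simp
  qed
  have adj: "adj U y = Some z" if "\<And>x. cinner (U \<cdot> x) y = cinner x z" for y z
  proof -
    have "(THE z. \<forall>x\<in>dom U. cinner (U \<cdot> x) y = cinner x z) = z"
      by (rule the_equality) (use that unique dom in auto)
    then show ?thesis
      using that by (auto simp: adj_def)
  qed
  have ex: "\<exists>z. \<forall>x. cinner (U \<cdot> x) y = cinner x z" for y
  proof -
    obtain p where p: "p \<in> ran U" "\<And>m. m \<in> ran U \<Longrightarrow> cinner m (y - p) = 0"
      using complex_orthogonal_projection_exists[OF csubspace_ran[OF \<open>is_operator U\<close>] closed] by blast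
    then obtain z where z: "p = U \<cdot> z"
      by (auto simp: mem_ran_iff)
    have "cinner (U \<cdot> x) y = cinner x z" for x
    proof -
      have "cinner (U \<cdot> x) y = cinner (U \<cdot> x) (U \<cdot> z)"
        using p(2)[of "U \<cdot> x"] dom by (auto simp: mem_ran_iff z cinner_diff_right)
      then show ?thesis
        by (simp add: isometry_preserves_cinner[OF lin isometry])
    qed
    then show ?thesis
      by blast
  qed
  show dom_adj: "dom (adj U) = UNIV"
    using ex adj by blast
  show eq: "cinner (U \<cdot> x) y = cinner x (adj U \<cdot> y)" for x y
    using ex adj by (metis option.sel)
  show "clinear (\<lambda>y. adj U \<cdot> y)"
    unfolding clinear_iff
    by (intro conjI allI; rule unique) (simp_all add: cinner_add_right cinner_scaleC_right flip: eq)
  show inverse: "adj U \<cdot> (U \<cdot> x) = x" for x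
    by (rule unique) (simp add: isometry_preserves_cinner[OF lin isometry] flip: eq)
  have "inner (y - U \<cdot> adj U \<cdot> y) (U \<cdot> adj U \<cdot> y) = 0" for y
  proof -
    have "cinner (U \<cdot> adj U \<cdot> y) (y - U \<cdot> adj U \<cdot> y) = 0"
      by (simp add: cinner_diff_right eq inverse)
    then show ?thesis
      by (metis Re_cinner inner_commute zero_complex.sel(1))
  qed
  then have "(norm y)\<^sup>2 = (norm (y - U \<cdot> adj U \<cdot> y))\<^sup>2 + (norm (U \<cdot> adj U \<cdot> y))\<^sup>2" for y
    using norm_add_Pythagorean[of "y - U \<cdot> adj U \<cdot> y" "U \<cdot> adj U \<cdot> y"] by (simp add: orthogonal_def)
  then show "(norm y)\<^sup>2 = (norm (y - U \<cdot> adj U \<cdot> y))\<^sup>2 + (norm (adj U \<cdot> y))\<^sup>2" for y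
    unfolding isometry .
qed


section \<open>Operator norms\<close>

lemma op_norm_le:
  assumes "dom A \<noteq> {}" and "N \<ge> 0" and "\<And>x. x \<in> dom A \<Longrightarrow> norm (A \<cdot> x) \<le> N * norm x"
  shows "op_norm A \<le> N"
  unfolding op_norm_def
proof (rule cSUP_least[OF assms(1)])
  show "norm (A \<cdot> x) / norm x \<le> N" if "x \<in> dom A" for x
    using assms(3)[OF that] assms(2) by (cases "x = 0") (auto simp: pos_divide_le_eq)
qed

lemma op_norm_upper:
  assumes "bounded_op A" and "x \<in> dom A"
  shows "norm (A \<cdot> x) / norm x \<le> op_norm A"
proof -
  obtain K where K: "\<And>x. x \<in> dom A \<Longrightarrow> norm (A \<cdot> x) \<le> K * norm x"
    using assms(1) by (auto simp: bounded_op_def)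
  have "bdd_above ((\<lambda>x. norm (A \<cdot> x) / norm x) ` dom A)"
  proof (rule bdd_aboveI2)
    fix x
    assume "x \<in> dom A"
    then have "norm (A \<cdot> x) \<le> K * norm x"
      by (rule K)
    also have "\<dots> \<le> max K 0 * norm x"
      by (intro mult_right_mono) auto
    finally show "norm (A \<cdot> x) / norm x \<le> max K 0"
      by (cases "x = 0") (auto simp: pos_divide_le_eq)
  qed
  then show ?thesis
    unfolding op_norm_def using assms(2) by (intro cSUP_upper)
qed

lemma norm_apply_le_op_norm:
  assumes "is_operator A" and "bounded_op A" and "x \<in> dom A"
  shows "norm (A \<cdot> x) \<le> op_norm A * norm x"
proof (cases "x = 0")
  case True
  then show ?thesis
    using is_operator_diff(2)[OF assms(1,3,3)] by simp
next
  case False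
  then show ?thesis
    using op_norm_upper[OF assms(2,3)] by (simp add: pos_divide_le_eq)
qed

lemma op_norm_nonneg:
  assumes "is_operator A" and "bounded_op A"
  shows "0 \<le> op_norm A"
  using op_norm_upper[OF assms(2), of 0] assms(1) by (simp add: is_operator_def csubspace_iff)

section \<open>Shifts of an operator\<close>

definition op_shift :: "('a::complex_hilbert_space \<rightharpoonup> 'a) \<Rightarrow> complex \<Rightarrow> ('a \<rightharpoonup> 'a)"
  where "op_shift A \<mu> = (\<lambda>x. map_option (\<lambda>y. y - \<mu> *\<^sub>C x) (A x))"

lemma op_spectrum_iff: "\<mu> \<in> op_spectrum A \<longleftrightarrow> \<not> invertible_op (op_shift A \<mu>)"
  by (simp add: op_spectrum_def op_shift_def)

lemma dom_op_shift [simp]: "dom (op_shift A \<mu>) = dom A"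
  by (auto simp: op_shift_def)

lemma op_shift_apply: "x \<in> dom A \<Longrightarrow> op_shift A \<mu> \<cdot> x = A \<cdot> x - \<mu> *\<^sub>C x"
  by (auto simp: op_shift_def)

lemma is_operator_op_shift:
  assumes "is_operator A"
  shows "is_operator (op_shift A \<mu>)"
  using assms unfolding is_operator_def csubspace_iff
  by (simp add: op_shift_apply scaleC_add_right scaleC_diff_right scaleC_scaleC mult.commute)

text \<open>
  The surjectivity half of the openness of the resolvent set. With \<open>R = (A - \<mu>)\<^sup>-\<^sup>1\<close>, a solution
  of \<open>(A - \<nu>)x = y\<close> is a fixed point of the contraction \<open>x \<mapsto> R(y + (\<nu> - \<mu>)x)\<close>.
\<close>

lemma surj_op_shift_perturbation:
  assumes op: "is_operator A"
    and K: "\<And>x. x \<in> dom A \<Longrightarrow> norm x \<le> K * norm (op_shift A \<mu> \<cdot> x)"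
    and surj: "\<And>y. \<exists>x\<in>dom A. op_shift A \<mu> \<cdot> x = y"
    and "K > 0" and near: "K * cmod (\<nu> - \<mu>) < 1"
  shows "\<exists>x\<in>dom A. op_shift A \<nu> \<cdot> x = y"
proof -
  obtain R where R: "\<And>y. R y \<in> dom A" "\<And>y. op_shift A \<mu> \<cdot> R y = y"
    using surj by metis
  have lipschitz: "norm (R y - R z) \<le> K * norm (y - z)" for y z
    using K[of "R y - R z"] is_operator_diff[OF is_operator_op_shift[OF op], of "R y" \<mu> "R z"] R
    by simp
  define f where "f x = R (y + (\<nu> - \<mu>) *\<^sub>C x)" for x
  have "\<exists>!x. f x = x"
  proof (rule banach_fix_type[of "K * cmod (\<nu> - \<mu>)"])
    show "\<forall>x z. dist (f x) (f z) \<le> K * cmod (\<nu> - \<mu>) * dist x z"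
    proof (intro allI)
      fix x z
      have "dist (f x) (f z) \<le> K * norm ((\<nu> - \<mu>) *\<^sub>C (x - z))"
        using lipschitz[of "y + (\<nu> - \<mu>) *\<^sub>C x" "y + (\<nu> - \<mu>) *\<^sub>C z"]
        by (simp add: f_def dist_norm scaleC_diff_right)
      then show "dist (f x) (f z) \<le> K * cmod (\<nu> - \<mu>) * dist x z"
        by (simp add: norm_scaleC dist_norm)
    qed
  qed (use \<open>K > 0\<close> near in auto)
  then obtain x where "f x = x"
    by blast
  then have x: "x \<in> dom A" "op_shift A \<mu> \<cdot> x = y + (\<nu> - \<mu>) *\<^sub>C x"
    using R unfolding f_def by metis+
  moreover have "\<nu> *\<^sub>C x = \<mu> *\<^sub>C x + (\<nu> - \<mu>) *\<^sub>C x"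
    by (simp flip: scaleC_add_left)
  ultimately have "op_shift A \<nu> \<cdot> x = y"
    by (simp add: op_shift_apply algebra_simps)
  with x(1) show ?thesis
    by blast
qed

text \<open>
  Let \<open>p = Ax\<^sub>0\<close> be the projection of \<open>y\<close> onto the range of \<open>A\<close>, and let \<open>x\<close> solve
  \<open>(A - \<mu>)x = y - \<mu>x\<^sub>0\<close>. Then \<open>v = y - Ax = \<mu>(x\<^sub>0 - x)\<close>, while the projection of \<open>v\<close> onto the range
  is \<open>w = A(x\<^sub>0 - x)\<close>. Hence \<open>c\<parallel>x\<^sub>0 - x\<parallel> \<le> \<parallel>w\<parallel> \<le> \<parallel>v\<parallel> = \<bar>\<mu>\<bar>\<parallel>x\<^sub>0 - x\<parallel>\<close>, which for \<open>\<bar>\<mu>\<bar> < c\<close> is only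
  possible when \<open>x = x\<^sub>0\<close>; then \<open>v = 0\<close> and \<open>y = Ax\<close>. This replaces the usual argument with the
  constancy of the index.
\<close>

lemma surj_if_op_shift_surj:
  assumes op: "is_operator A" and "closed_op A" and "c > 0"
    and below: "\<And>x. x \<in> dom A \<Longrightarrow> c * norm x \<le> norm (A \<cdot> x)"
    and surj: "\<And>y. \<exists>x\<in>dom A. op_shift A \<mu> \<cdot> x = y" and "cmod \<mu> < c"
  shows "\<exists>x\<in>dom A. A \<cdot> x = y"
proof -
  obtain p where p: "p \<in> ran A" "\<And>m. m \<in> ran A \<Longrightarrow> cinner m (y - p) = 0"
    using complex_orthogonal_projection_exists[OF csubspace_ran[OF op]
        closed_ran_if_bounded_below[OF assms(1-3) below]] by blast
  obtain x0 where x0: "x0 \<in> dom A" "p = A \<cdot> x0"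
    using p(1) by (auto simp: mem_ran_iff)
  obtain x where x: "x \<in> dom A" "op_shift A \<mu> \<cdot> x = y - \<mu> *\<^sub>C x0"
    using surj by blast
  define v where "v = y - A \<cdot> x"
  define w where "w = A \<cdot> x0 - A \<cdot> x"
  have v: "v = \<mu> *\<^sub>C (x0 - x)"
    using x by (simp add: v_def op_shift_apply scaleC_diff_right algebra_simps)
  have w: "w = A \<cdot> (x0 - x)" "x0 - x \<in> dom A"
    using is_operator_diff[OF op x0(1) x(1)] by (simp_all add: w_def)
  have "norm w \<le> norm v"
  proof -
    have "w \<in> ran A"
      using w by (auto simp: mem_ran_iff)
    then have "inner w (y - p) = 0"
      using p(2) by (metis Re_cinner zero_complex.sel(1))
    then have "(norm (w + (y - p)))\<^sup>2 = (norm w)\<^sup>2 + (norm (y - p))\<^sup>2"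
      by (intro norm_add_Pythagorean) (simp add: orthogonal_def)
    then have "(norm w)\<^sup>2 \<le> (norm v)\<^sup>2"
      by (simp add: v_def w_def x0(2))
    then show ?thesis
      by (rule power2_le_imp_le) simp
  qed
  then have "c * norm (x0 - x) \<le> cmod \<mu> * norm (x0 - x)"
    using below[OF w(2)] by (simp add: w(1) v norm_scaleC)
  then have "x0 - x = 0"
    using \<open>cmod \<mu> < c\<close> by (simp add: mult_le_cancel_right)
  then have "v = 0"
    by (simp add: v scaleC_zero_right)
  with x(1) show ?thesis
    by (auto simp: v_def)
qed

text \<open>
  The estimate behind \<open>surj_if_op_shift_surj\<close> is not strict on the circle \<open>\<bar>\<mu>\<bar> = c\<close>, so \<open>\<mu>\<close> is first moved radially into
  the open disc, by so little that the shifted operator stays onto.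
\<close>

lemma invertible_if_op_shift_invertible:
  assumes op: "is_operator A" and "closed_op A" and "c > 0"
    and below: "\<And>x. x \<in> dom A \<Longrightarrow> c * norm x \<le> norm (A \<cdot> x)"
    and inv: "invertible_op (op_shift A \<mu>)" and "cmod \<mu> \<le> c"
  shows "invertible_op A"
proof -
  obtain K where K: "K > 0" "\<And>x. x \<in> dom A \<Longrightarrow> norm x \<le> K * norm (op_shift A \<mu> \<cdot> x)"
    and surj: "\<And>y. \<exists>x\<in>dom A. op_shift A \<mu> \<cdot> x = y"
    using invertible_opE[OF inv] by (metis dom_op_shift)
  have "\<exists>\<nu>. cmod \<nu> < c \<and> K * cmod (\<nu> - \<mu>) < 1"
  proof -
    \<comment> \<open>chosen so that \<open>Ktc < 1\<close> and \<open>t \<le> 1\<close>\<close>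
    define t where "t = 1 / (1 + K * c)"
    have t: "0 < t" "t \<le> 1" "K * (t * c) < 1"
      using K(1) \<open>c > 0\<close> by (auto simp: t_def field_simps add_pos_pos)
    define \<nu> where "\<nu> = complex_of_real (1 - t) * \<mu>"
    have "cmod \<nu> = (1 - t) * cmod \<mu>"
      using t by (simp add: \<nu>_def norm_mult del: of_real_diff)
    also have "\<dots> \<le> (1 - t) * c"
      using t \<open>cmod \<mu> \<le> c\<close> by (intro mult_left_mono) auto
    also have "\<dots> < c"
      using t \<open>c > 0\<close> by (simp add: algebra_simps)
    finally have "cmod \<nu> < c" .
    have "\<nu> - \<mu> = - (complex_of_real t * \<mu>)"
      by (simp add: \<nu>_def algebra_simps)
    then have "K * cmod (\<nu> - \<mu>) = K * (t * cmod \<mu>)"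
      using t by (simp add: norm_mult)
    also have "\<dots> \<le> K * (t * c)"
      using t K(1) \<open>cmod \<mu> \<le> c\<close> by (intro mult_left_mono) auto
    also have "\<dots> < 1"
      by (rule t)
    finally show ?thesis
      using \<open>cmod \<nu> < c\<close> by blast
  qed
  then obtain \<nu> where \<nu>: "cmod \<nu> < c" "K * cmod (\<nu> - \<mu>) < 1"
    by blast
  have "\<exists>x\<in>dom A. A \<cdot> x = y" for y
    using surj_if_op_shift_surj[OF assms(1-3) below
        surj_op_shift_perturbation[OF op K(2) surj K(1) \<nu>(2)] \<nu>(1)] by blast
  then show ?thesis
    using invertible_opI(1)[OF _ op \<open>c > 0\<close> below] by blast
qed

section \<open>Upper triangular block operators\<close>

definition triangular_op :: "('a::complex_hilbert_space \<rightharpoonup> 'a) \<Rightarrow> ('b::complex_hilbert_space \<Rightarrow> 'a) \<Rightarrow>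
    ('b \<Rightarrow> 'b) \<Rightarrow> ('a \<times> 'b \<rightharpoonup> 'a \<times> 'b)"
  where "triangular_op A q d = (\<lambda>(x\<^sub>1, x\<^sub>2). if x\<^sub>1 \<in> dom A then Some (A \<cdot> x\<^sub>1 + q x\<^sub>2, d x\<^sub>2) else None)"

lemma dom_triangular_op [simp]: "dom (triangular_op A q d) = dom A \<times> UNIV"
  by (auto simp: triangular_op_def split: if_splits)

lemma triangular_op_apply:
  "x\<^sub>1 \<in> dom A \<Longrightarrow> triangular_op A q d \<cdot> (x\<^sub>1, x\<^sub>2) = (A \<cdot> x\<^sub>1 + q x\<^sub>2, d x\<^sub>2)"
  by (simp add: triangular_op_def)

lemma is_operator_triangular_op:
  assumes "is_operator A" and "clinear q" and "clinear d"
  shows "is_operator (triangular_op A q d)"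
  using assms unfolding is_operator_def csubspace_iff clinear_iff
  by (auto simp: triangular_op_apply scaleC_prod_def scaleC_add_right zero_prod_def)

lemma op_shift_triangular_op:
  "op_shift (triangular_op A q d) \<mu> = triangular_op (op_shift A \<mu>) q (\<lambda>x. d x - \<mu> *\<^sub>C x)"
  by (rule ext)
    (auto simp: op_shift_def triangular_op_def scaleC_prod_def split: prod.splits)

lemma clinear_diff_scaleC:
  assumes "clinear d"
  shows "clinear (\<lambda>x. d x - \<mu> *\<^sub>C x)"
  using assms by (simp add: clinear_iff scaleC_add_right scaleC_diff_right scaleC_scaleC mult.commute)

text \<open>
  Back substitution: the second row determines \<open>x\<^sub>2\<close>, after which the first row determines
  \<open>x\<^sub>1\<close>. The constant \<open>M\<close> bounds the solution by the right-hand side along the same route.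
\<close>

lemma invertible_triangular_op:
  assumes op: "is_operator A" and "invertible_op A" and q: "clinear q" "bounded_linear q" and d: "clinear d"
    and "k > 0" and d_below: "\<And>x. k * norm x \<le> norm (d x)" and d_surj: "surj d"
  shows "invertible_op (triangular_op A q d)"
proof -
  obtain K where K: "K > 0" "\<And>x. x \<in> dom A \<Longrightarrow> norm x \<le> K * norm (A \<cdot> x)"
    and surj: "\<And>y. \<exists>x\<in>dom A. A \<cdot> x = y"
    using invertible_opE[OF assms(2)] by blast
  obtain L where L: "L > 0" "\<And>x. norm (q x) \<le> L * norm x"
    using bounded_linear.pos_bounded[OF q(2)] by (metis mult.commute)
  define M where "M = K * (1 + L / k) + 1 / k"
  have "M > 0"
    unfolding M_def using K(1) L(1) \<open>k > 0\<close> by (intro add_pos_pos mult_pos_pos divide_pos_pos) auto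
  have bound: "norm (x\<^sub>1, x\<^sub>2) \<le> M * norm (A \<cdot> x\<^sub>1 + q x\<^sub>2, d x\<^sub>2)" if "x\<^sub>1 \<in> dom A" for x\<^sub>1 x\<^sub>2
  proof -
    define y where "y = norm (A \<cdot> x\<^sub>1 + q x\<^sub>2, d x\<^sub>2)"
    have y: "norm (A \<cdot> x\<^sub>1 + q x\<^sub>2) \<le> y" "norm (d x\<^sub>2) \<le> y"
      using norm_fst_le[of "A \<cdot> x\<^sub>1 + q x\<^sub>2" "d x\<^sub>2"] norm_snd_le[of "d x\<^sub>2" "A \<cdot> x\<^sub>1 + q x\<^sub>2"]
      by (simp_all add: y_def)
    have x2: "norm x\<^sub>2 \<le> y / k"
      using d_below[of x\<^sub>2] y(2) \<open>k > 0\<close> by (simp add: pos_le_divide_eq mult.commute)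
    have "norm (A \<cdot> x\<^sub>1) \<le> norm (A \<cdot> x\<^sub>1 + q x\<^sub>2) + norm (q x\<^sub>2)"
      by (metis add_diff_cancel_right' norm_triangle_ineq4)
    also have "\<dots> \<le> y + L * (y / k)"
      using y(1) L(2)[of x\<^sub>2] mult_left_mono[OF x2, of L] L(1) by linarith
    finally have "norm x\<^sub>1 \<le> K * (y + L * (y / k))"
      using K(2)[OF that] mult_left_mono[of "norm (A \<cdot> x\<^sub>1)" "y + L * (y / k)" K] K(1) by linarith
    moreover have "norm (x\<^sub>1, x\<^sub>2) \<le> norm x\<^sub>1 + norm x\<^sub>2"
      by (rule norm_Pair_le)
    ultimately have "norm (x\<^sub>1, x\<^sub>2) \<le> K * (y + L * (y / k)) + y / k"
      using x2 by linarith
    also have "\<dots> = M * y"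
      by (simp add: M_def algebra_simps)
    finally show ?thesis
      by (simp add: y_def)
  qed
  show ?thesis
  proof (rule invertible_opI(1))
    show "is_operator (triangular_op A q d)"
      by (rule is_operator_triangular_op[OF op q(1) d])
    show "1 / M > 0"
      using \<open>M > 0\<close> by simp
    show "1 / M * norm z \<le> norm (triangular_op A q d \<cdot> z)" if dom: "z \<in> dom (triangular_op A q d)" for z
    proof -
      obtain x\<^sub>1 x\<^sub>2 where z: "z = (x\<^sub>1, x\<^sub>2)" "x\<^sub>1 \<in> dom A"
        using dom by auto
      then have "norm z \<le> M * norm (triangular_op A q d \<cdot> z)"
        using bound[OF z(2)] by (simp add: triangular_op_apply[OF z(2)])
      then show ?thesis
        using \<open>M > 0\<close> by (simp add: pos_divide_le_eq mult.commute)
    qed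
    show "\<exists>z\<in>dom (triangular_op A q d). triangular_op A q d \<cdot> z = y" for y
    proof -
      obtain x\<^sub>2 where x2: "d x\<^sub>2 = snd y"
        using d_surj by (metis surjD)
      obtain x\<^sub>1 where "x\<^sub>1 \<in> dom A" "A \<cdot> x\<^sub>1 = fst y - q x\<^sub>2"
        using surj by blast
      then show ?thesis
        by (intro bexI[of _ "(x\<^sub>1, x\<^sub>2)"]) (auto simp: triangular_op_apply x2)
    qed
  qed
qed

text \<open>
  For \<open>\<parallel>d\<parallel> \<le> c < \<bar>\<mu>\<bar>\<close> the equation \<open>dx - \<mu>x = y\<close> is the fixed point equation
  \<open>x = \<mu>\<^sup>-\<^sup>1(dx - y)\<close> of a contraction.
\<close>

lemma contraction_minus_scalar_invertible:
  fixes d :: "'a::complex_hilbert_space \<Rightarrow> 'a"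
  assumes d: "clinear d" and bound: "\<And>x. norm (d x) \<le> c * norm x" and "0 \<le> c" "c < cmod \<mu>"
  shows "(cmod \<mu> - c) * norm x \<le> norm (d x - \<mu> *\<^sub>C x)" and "surj (\<lambda>x. d x - \<mu> *\<^sub>C x)"
proof -
  have "norm (\<mu> *\<^sub>C x) - norm (d x) \<le> norm (d x - \<mu> *\<^sub>C x)"
    by (metis norm_minus_commute norm_triangle_ineq2)
  then show "(cmod \<mu> - c) * norm x \<le> norm (d x - \<mu> *\<^sub>C x)"
    using bound[of x] by (simp add: norm_scaleC algebra_simps)
  have "\<mu> \<noteq> 0"
    using assms(3,4) by auto
  have diff: "d x - d y = d (x - y)" for x y
    using linear_diff[OF clinear_imp_linear[OF d]] by simp
  have "\<exists>x. d x - \<mu> *\<^sub>C x = y" for y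
  proof -
    define f where "f x = inverse \<mu> *\<^sub>C (d x - y)" for x
    have "\<exists>!x. f x = x"
    proof (rule banach_fix_type[of "c / cmod \<mu>"])
      show "\<forall>x z. dist (f x) (f z) \<le> c / cmod \<mu> * dist x z"
      proof (intro allI)
        fix x z
        have "f x - f z = inverse \<mu> *\<^sub>C d (x - z)"
          by (simp add: f_def diff[symmetric] scaleC_diff_right[symmetric])
        then show "dist (f x) (f z) \<le> c / cmod \<mu> * dist x z"
          using divide_right_mono[OF bound[of "x - z"], of "cmod \<mu>"]
          by (simp add: dist_norm norm_scaleC norm_inverse divide_inverse mult_ac)
      qed
    qed (use assms(3,4) \<open>\<mu> \<noteq> 0\<close> in \<open>auto simp: pos_divide_less_eq\<close>)
    then obtain x where "f x = x"
      by blast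
    then have "\<mu> *\<^sub>C x = \<mu> *\<^sub>C (inverse \<mu> *\<^sub>C (d x - y))"
      by (simp add: f_def)
    also have "\<dots> = 1 *\<^sub>C (d x - y)"
      using \<open>\<mu> \<noteq> 0\<close> by (simp add: scaleC_scaleC)
    also have "\<dots> = d x - y"
      by (metis of_real_1 scaleC_of_real scaleR_one)
    finally show ?thesis
      by (intro exI[of _ x]) simp
  qed
  then show "surj (\<lambda>x. d x - \<mu> *\<^sub>C x)"
    by (metis surjI)
qed

text \<open>
  A point \<open>\<mu>\<close> of the resolvent set of \<open>A\<close> has \<open>\<bar>\<mu>\<bar> > c\<close>, since otherwise \<open>A\<close> would be invertible.
  Thus both diagonal entries of the shifted block operator are invertible.
\<close>

lemma op_spectrum_triangular_op_subset:
  assumes op: "is_operator A" and "closed_op A" and "c > 0"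
    and below: "\<And>x. x \<in> dom A \<Longrightarrow> c * norm x \<le> norm (A \<cdot> x)"
    and "\<not> invertible_op A"
    and q: "clinear q" "bounded_linear q" and d: "clinear d" "\<And>x. norm (d x) \<le> c * norm x"
  shows "op_spectrum (triangular_op A q d) \<subseteq> op_spectrum A"
proof
  fix \<mu>
  assume "\<mu> \<in> op_spectrum (triangular_op A q d)"
  then have not_inv: "\<not> invertible_op (triangular_op (op_shift A \<mu>) q (\<lambda>x. d x - \<mu> *\<^sub>C x))"
    by (simp add: op_spectrum_iff op_shift_triangular_op)
  have "\<not> invertible_op (op_shift A \<mu>)"
  proof
    assume inv: "invertible_op (op_shift A \<mu>)"
    then have large: "c < cmod \<mu>"
      using invertible_if_op_shift_invertible[OF assms(1-3) below] assms(5) by fastforce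
    have "invertible_op (triangular_op (op_shift A \<mu>) q (\<lambda>x. d x - \<mu> *\<^sub>C x))"
    proof (rule invertible_triangular_op)
      show "is_operator (op_shift A \<mu>)"
        by (rule is_operator_op_shift[OF op])
      show "cmod \<mu> - c > 0"
        using large by simp
      show "surj (\<lambda>x. d x - \<mu> *\<^sub>C x)"
        using contraction_minus_scalar_invertible(2)[OF d _ large] \<open>c > 0\<close> by simp
      show "(cmod \<mu> - c) * norm x \<le> norm (d x - \<mu> *\<^sub>C x)" for x
        using contraction_minus_scalar_invertible(1)[OF d _ large] \<open>c > 0\<close> by simp
    qed (use inv q clinear_diff_scaleC[OF d(1)] in auto)
    with not_inv show False ..
  qed
  then show "\<mu> \<in> op_spectrum A"
    by (simp add: op_spectrum_iff)
qed

section \<open>Blocks that complete a bounded below operator\<close>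

text \<open>
  The two hypotheses say that the second column \<open>(q, d)\<close> is \<open>c\<close> times an isometry and that \<open>q\<close> is
  orthogonal to \<open>y\<close>; in the applications \<open>y\<close> ranges over the range of \<open>A\<close>.
\<close>

lemma norm_triangular_op:
  assumes "\<And>x. (norm (q x))\<^sup>2 + (norm (d x))\<^sup>2 = (c * norm x)\<^sup>2"
    and "\<And>x. inner y (q x) = 0"
  shows "(norm (y + q x, d x))\<^sup>2 = (norm y)\<^sup>2 + (c * norm x)\<^sup>2"
proof -
  have "(norm (y + q x, d x))\<^sup>2 = (norm (y + q x))\<^sup>2 + (norm (d x))\<^sup>2"
    by (simp add: norm_Pair)
  also have "(norm (y + q x))\<^sup>2 = (norm y)\<^sup>2 + (norm (q x))\<^sup>2"
    by (rule norm_add_Pythagorean) (simp add: orthogonal_def assms(2))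
  finally show ?thesis
    using assms(1)[of x] by simp
qed

lemma outer_extension_triangular_op:
  fixes A :: "'a::complex_hilbert_space \<rightharpoonup> 'a" and q :: "'b::complex_hilbert_space \<Rightarrow> 'a"
  assumes "is_operator A" and "clinear q" and "clinear d"
  shows "outer_extension (\<lambda>x. (x, 0)) (triangular_op A q d) A"
proof -
  have range: "range (\<lambda>x :: 'a. (x, 0 :: 'b)) = UNIV \<times> {0}"
    by auto
  have "q 0 = 0" "d 0 = 0"
    using assms(2,3)[THEN clinear_imp_linear] by (simp_all add: linear_0)
  then show ?thesis
    unfolding outer_extension_def range
    using linear_0[OF clinear_imp_linear[of "\<lambda>x :: 'b. x"]] scaleC_diff_right[of _ "0 :: 'b" 0]
    by (auto simp: clinear_iff scaleC_prod_def norm_Pair triangular_op_apply closed_Times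
        is_operator_triangular_op[OF assms])
qed

text \<open>
  By \<open>norm_triangular_op\<close> the block operator inherits the lower bound \<open>c\<close> from \<open>A\<close>. The last
  hypothesis is what surjectivity requires: \<open>q\<close> must be able to remove from \<open>y\<^sub>1\<close> the part outside
  the range of \<open>A\<close>, independently of the prescribed second component \<open>y\<^sub>2\<close>.
\<close>

lemma invertible_completed_triangular_op:
  assumes op: "is_operator A" and q: "clinear q" and d: "clinear d" and "c > 0"
    and below: "\<And>x. x \<in> dom A \<Longrightarrow> c * norm x \<le> norm (A \<cdot> x)"
    and norms: "\<And>x. (norm (q x))\<^sup>2 + (norm (d x))\<^sup>2 = (c * norm x)\<^sup>2"
    and ortho: "\<And>x y. x \<in> dom A \<Longrightarrow> inner (A \<cdot> x) (q y) = 0"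
    and surj: "\<And>y\<^sub>1 y\<^sub>2. \<exists>x\<^sub>2. d x\<^sub>2 = y\<^sub>2 \<and> y\<^sub>1 - q x\<^sub>2 \<in> ran A"
  shows "invertible_op (triangular_op A q d)"
    and "op_norm (op_inverse (triangular_op A q d)) \<le> inverse c"
proof -
  have ex: "\<exists>z\<in>dom (triangular_op A q d). triangular_op A q d \<cdot> z = y" for y
  proof -
    obtain x\<^sub>1 x\<^sub>2 where "d x\<^sub>2 = snd y" "x\<^sub>1 \<in> dom A" "fst y - q x\<^sub>2 = A \<cdot> x\<^sub>1"
      using surj[of "snd y" "fst y"] by (auto simp: mem_ran_iff)
    then show ?thesis
      by (intro bexI[of _ "(x\<^sub>1, x\<^sub>2)"]) (auto simp: triangular_op_apply algebra_simps prod_eq_iff)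
  qed
  have bound: "c * norm z \<le> norm (triangular_op A q d \<cdot> z)" if dom: "z \<in> dom (triangular_op A q d)" for z
  proof -
    obtain x\<^sub>1 x\<^sub>2 where z: "z = (x\<^sub>1, x\<^sub>2)" "x\<^sub>1 \<in> dom A"
      using dom by auto
    have "(c * norm z)\<^sup>2 = (c * norm x\<^sub>1)\<^sup>2 + (c * norm x\<^sub>2)\<^sup>2"
      by (simp add: z norm_Pair power_mult_distrib distrib_left)
    also have "\<dots> \<le> (norm (A \<cdot> x\<^sub>1))\<^sup>2 + (c * norm x\<^sub>2)\<^sup>2"
      using below[OF z(2)] \<open>c > 0\<close> by (intro add_right_mono power_mono) auto
    also have "\<dots> = (norm (triangular_op A q d \<cdot> z))\<^sup>2"
      using z(2) by (simp add: z(1) triangular_op_apply norm_triangular_op[OF norms ortho])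
    finally show ?thesis
      by (rule power2_le_imp_le) simp
  qed
  show "invertible_op (triangular_op A q d)"
    and "op_norm (op_inverse (triangular_op A q d)) \<le> inverse c"
    using invertible_opI[OF ex is_operator_triangular_op[OF op q d] \<open>c > 0\<close> bound] by blast+
qed

text \<open>
  In \<open>\<parallel>Bz\<parallel>\<^sup>2 = \<parallel>Ax\<^sub>1\<parallel>\<^sup>2 + c\<^sup>2\<parallel>x\<^sub>2\<parallel>\<^sup>2\<close> the second term is at most \<open>\<parallel>A\<parallel>\<^sup>2\<parallel>x\<^sub>2\<parallel>\<^sup>2\<close>, because a
  nonzero space has a nonzero vector in the dense domain of \<open>A\<close>, where \<open>c\<parallel>x\<parallel> \<le> \<parallel>Ax\<parallel> \<le> \<parallel>A\<parallel>\<parallel>x\<parallel>\<close>.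
\<close>

lemma op_norm_completed_triangular_op:
  fixes A :: "'a::complex_hilbert_space \<rightharpoonup> 'a"
  assumes op: "is_operator A" and q: "clinear q" and d: "clinear d" and "c > 0"
    and dense: "densely_defined A" and bdd: "bounded_op A"
    and below: "\<And>x. x \<in> dom A \<Longrightarrow> c * norm x \<le> norm (A \<cdot> x)"
    and norms: "\<And>x :: 'a. (norm (q x))\<^sup>2 + (norm (d x))\<^sup>2 = (c * norm x)\<^sup>2"
    and ortho: "\<And>x y. x \<in> dom A \<Longrightarrow> inner (A \<cdot> x) (q y) = 0"
  shows "bounded_op (triangular_op A q d)" and "op_norm (triangular_op A q d) = op_norm A"
proof -
  have opB: "is_operator (triangular_op A q d)"
    by (rule is_operator_triangular_op[OF op q d])
  have "0 \<in> dom A"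
    using op by (simp add: is_operator_def csubspace_iff)
  have q0: "q 0 = 0" and d0: "d 0 = 0"
    using linear_0[OF clinear_imp_linear[OF q]] linear_0[OF clinear_imp_linear[OF d]] by auto
  have second: "c * norm y \<le> op_norm A * norm y" for y :: 'a
  proof (cases "y = 0")
    case False
    have "\<exists>x\<in>dom A. x \<noteq> 0"
    proof (rule ccontr)
      assume "\<not> ?thesis"
      then have "closure (dom A) \<subseteq> {0}"
        by (intro closure_minimal) auto
      then show False
        using dense False by (auto simp: densely_defined_def)
    qed
    then obtain x where x: "x \<in> dom A" "x \<noteq> 0"
      by blast
    then have "c * norm x \<le> op_norm A * norm x"
      using below[OF x(1)] norm_apply_le_op_norm[OF op bdd x(1)] by linarith
    then have "c \<le> op_norm A"
      using x(2) by simp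
    then show ?thesis
      by (rule mult_right_mono) simp
  qed simp
  have bound: "norm (triangular_op A q d \<cdot> z) \<le> op_norm A * norm z"
    if dom: "z \<in> dom (triangular_op A q d)" for z
  proof -
    obtain x\<^sub>1 x\<^sub>2 where z: "z = (x\<^sub>1, x\<^sub>2)" "x\<^sub>1 \<in> dom A"
      using dom by auto
    have "(norm (triangular_op A q d \<cdot> z))\<^sup>2 = (norm (A \<cdot> x\<^sub>1))\<^sup>2 + (c * norm x\<^sub>2)\<^sup>2"
      using z(2) by (simp add: z(1) triangular_op_apply norm_triangular_op[OF norms ortho])
    also have "\<dots> \<le> (op_norm A * norm x\<^sub>1)\<^sup>2 + (op_norm A * norm x\<^sub>2)\<^sup>2"
      using norm_apply_le_op_norm[OF op bdd z(2)] second \<open>c > 0\<close>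
      by (intro add_mono power_mono) auto
    also have "\<dots> = (op_norm A * norm z)\<^sup>2"
      by (simp add: z norm_Pair power_mult_distrib distrib_left)
    finally show ?thesis
      by (rule power2_le_imp_le) (simp add: op_norm_nonneg[OF op bdd])
  qed
  then show bddB: "bounded_op (triangular_op A q d)"
    unfolding bounded_op_def by blast
  show "op_norm (triangular_op A q d) = op_norm A"
  proof (rule antisym)
    show "op_norm (triangular_op A q d) \<le> op_norm A"
      using bound op_norm_nonneg[OF op bdd] \<open>0 \<in> dom A\<close> by (intro op_norm_le) auto
    have bound_A: "norm (A \<cdot> x) \<le> op_norm (triangular_op A q d) * norm x" if "x \<in> dom A" for x
      using norm_apply_le_op_norm[OF opB bddB, of "(x, 0)"] that
      by (simp add: triangular_op_apply q0 d0 norm_Pair)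
    show "op_norm A \<le> op_norm (triangular_op A q d)"
      using bound_A op_norm_nonneg[OF opB bddB] \<open>0 \<in> dom A\<close> by (intro op_norm_le) auto
  qed
qed


section \<open>Strongly continuous semigroups\<close>

lemma semigroup_generator_eq_Some_iff:
  "semigroup_generator T x = Some y \<longleftrightarrow> ((\<lambda>t. (T t x - x) /\<^sub>R t) \<longlongrightarrow> y) (at_right 0)"
  unfolding semigroup_generator_def using tendsto_Lim[OF trivial_limit_at_right_real] by force

text \<open>
  If no such bound existed, there would be times \<open>t\<^sub>n \<rightarrow> 0\<close> at which the operators \<open>T(t\<^sub>n)\<close> are not
  uniformly bounded, although \<open>T(t\<^sub>n)y \<rightarrow> y\<close> for every \<open>y\<close>.
\<close>

lemma C0_semigroup_bounded_near_zero:
  assumes T: "C0_semigroup T"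
  obtains \<delta> M where "\<delta> > 0" and "M \<ge> 1" and "\<And>t x. 0 \<le> t \<Longrightarrow> t \<le> \<delta> \<Longrightarrow> norm (T t x) \<le> M * norm x"
proof -
  have lin: "\<And>t. t \<ge> 0 \<Longrightarrow> bounded_linear (T t)" and T0: "T 0 = id"
    and lim: "\<And>x. ((\<lambda>t. T t x) \<longlongrightarrow> x) (at_right 0)"
    using T by (auto simp: C0_semigroup_def)
  have "\<exists>n::nat. \<forall>t x. 0 \<le> t \<longrightarrow> t \<le> inverse (real (Suc n)) \<longrightarrow> norm (T t x) \<le> real (Suc n) * norm x"
  proof (rule ccontr)
    assume "\<not> ?thesis"
    then have "\<forall>n::nat. \<exists>t x. 0 \<le> t \<and> t \<le> inverse (real (Suc n)) \<and> norm (T t x) > real (Suc n) * norm x"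
      by (meson not_le)
    then obtain t x where t: "\<And>n::nat. 0 \<le> t n" "\<And>n. t n \<le> inverse (real (Suc n))"
      and large: "\<And>n. norm (T (t n) (x n)) > real (Suc n) * norm (x n)"
      by metis
    have "t \<longlonglongrightarrow> 0"
      by (rule tendsto_sandwich[OF _ _ tendsto_const LIMSEQ_inverse_real_of_nat]) (use t in auto)
    have "(\<lambda>n. T (t n) y) \<longlonglongrightarrow> y" for y
    proof -
      have "((\<lambda>s. T s y) \<longlongrightarrow> T 0 y) (at 0 within {0..})"
        using lim[of y] by (simp add: T0 at_within_Ici_at_right)
      then have "continuous (at 0 within {0..}) (\<lambda>s. T s y)"
        by (simp add: continuous_within)
      then have "(\<lambda>n. T (t n) y) \<longlonglongrightarrow> T 0 y"
        using t(1) \<open>t \<longlonglongrightarrow> 0\<close> unfolding continuous_within_sequentially comp_def by auto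
      then show ?thesis
        by (simp add: T0)
    qed
    then have "Bseq (\<lambda>n. T (t n) y)" for y
      by (meson convergentI convergent_imp_Bseq)
    then have pointwise: "\<exists>K. \<forall>f\<in>range (\<lambda>n. T (t n)). norm (f y) \<le> K" for y
      by (auto simp: Bseq_def)
    obtain K where K: "K \<ge> 0" "\<And>f y. f \<in> range (\<lambda>n. T (t n)) \<Longrightarrow> norm (f y) \<le> K * norm y"
      using uniform_boundedness[OF _ pointwise] lin t(1) by blast
    obtain n where "K \<le> real n"
      using real_arch_simple by blast
    then have "K * norm (x n) \<le> real (Suc n) * norm (x n)"
      by (intro mult_right_mono) auto
    with K(2)[of "T (t n)" "x n"] large[of n] show False
      by auto
  qed
  then obtain n :: nat where "\<And>t x. 0 \<le> t \<Longrightarrow> t \<le> inverse (real (Suc n)) \<Longrightarrow> norm (T t x) \<le> real (Suc n) * norm x"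
    by blast
  then show ?thesis
    by (intro that[of "inverse (real (Suc n))" "real (Suc n)"]) auto
qed

lemma C0_semigroup_locally_bounded:
  assumes T: "C0_semigroup T"
  obtains M where "M > 0" and "\<And>t x. 0 \<le> t \<Longrightarrow> t \<le> a \<Longrightarrow> norm (T t x) \<le> M * norm x"
proof -
  obtain \<delta> M where \<delta>: "\<delta> > 0" and M: "M \<ge> 1"
    "\<And>t x. 0 \<le> t \<Longrightarrow> t \<le> \<delta> \<Longrightarrow> norm (T t x) \<le> M * norm x"
    using C0_semigroup_bounded_near_zero[OF T] by blast
  have law: "T (s + t) x = T s (T t x)" if "0 \<le> s" "0 \<le> t" for s t x
    using T that by (simp add: C0_semigroup_def)
  have bound: "norm (T t x) \<le> M ^ Suc n * norm x" if "0 \<le> t" "t \<le> real (Suc n) * \<delta>" for n t x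
    using that
  proof (induction n arbitrary: t x)
    case 0
    then show ?case
      using M(2) by simp
  next
    case (Suc n)
    show ?case
    proof (cases "t \<le> \<delta>")
      case True
      have "norm (T t x) \<le> M ^ 1 * norm x"
        using M(2)[OF Suc.prems(1) True] by simp
      also have "\<dots> \<le> M ^ Suc (Suc n) * norm x"
        using M(1) by (intro mult_right_mono power_increasing) auto
      finally show ?thesis .
    next
      case False
      then have "norm (T t x) = norm (T \<delta> (T (t - \<delta>) x))"
        using \<delta> law[of \<delta> "t - \<delta>" x] by simp
      also have "\<dots> \<le> M * norm (T (t - \<delta>) x)"
        using \<delta> by (intro M(2)) auto
      also have "\<dots> \<le> M * (M ^ Suc n * norm x)"
        using False Suc.prems M(1) by (intro mult_left_mono Suc.IH) (auto simp: algebra_simps)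
      finally show ?thesis
        by (simp add: mult.assoc)
    qed
  qed
  obtain n :: nat where "a / \<delta> \<le> real n"
    using real_arch_simple by blast
  then have "a \<le> real (Suc n) * \<delta>"
    using \<delta> by (simp add: pos_divide_le_eq algebra_simps)
  then show ?thesis
    using that[of "M ^ Suc n"] bound M(1) by (meson order_trans zero_less_one less_le_trans zero_less_power)
qed

text \<open>
  Continuity from the right at \<open>0\<close> spreads to both sides of every \<open>t\<close>: for \<open>r \<le> s\<close> one has
  \<open>T(s)x - T(r)x = T(r)(T(s - r)x - x)\<close>, and \<open>T(r)\<close> is bounded uniformly for \<open>r\<close> near \<open>t\<close>.
\<close>

lemma C0_semigroup_continuous:
  assumes T: "C0_semigroup T"
  shows "continuous_on {0..} (\<lambda>t. T t x)"
  unfolding continuous_on_iff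
proof (intro ballI allI impI)
  fix t e :: real
  assume "t \<in> {0..}" and "e > 0"
  have T0: "T 0 = id" and lim: "((\<lambda>t. T t x) \<longlongrightarrow> x) (at_right 0)"
    and law: "\<And>s t x. 0 \<le> s \<Longrightarrow> 0 \<le> t \<Longrightarrow> T (s + t) x = T s (T t x)"
    and lin: "\<And>t. t \<ge> 0 \<Longrightarrow> linear (T t)"
    using T by (auto simp: C0_semigroup_def bounded_linear.linear)
  obtain M where M: "M > 0" "\<And>s x. 0 \<le> s \<Longrightarrow> s \<le> t + 1 \<Longrightarrow> norm (T s x) \<le> M * norm x"
    using C0_semigroup_locally_bounded[OF T] by blast
  have "\<forall>\<^sub>F h in at_right 0. dist (T h x) x < e / M"
    using lim M(1) \<open>e > 0\<close> by (intro tendstoD) auto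
  then obtain b where b: "b > 0" "\<And>h. 0 < h \<Longrightarrow> h < b \<Longrightarrow> dist (T h x) x < e / M"
    by (auto simp: eventually_at_right[of 0 1])
  have increment: "dist (T r x) (T s x) < e" if "0 \<le> r" "r \<le> s" "s \<le> t + 1" "s - r < b" for r s
  proof (cases "r = s")
    case False
    have "T s x = T r (T (s - r) x)"
      using that law[of r "s - r" x] by simp
    then have "T s x - T r x = T r (T (s - r) x - x)"
      using lin[OF that(1)] by (simp add: linear_diff)
    then have "norm (T s x - T r x) \<le> M * norm (T (s - r) x - x)"
      using M(2)[of r] that by simp
    also have "\<dots> < M * (e / M)"
      using b(2)[of "s - r"] that False M(1) by (intro mult_strict_left_mono) (auto simp: dist_norm)
    finally show ?thesis
      using M(1) by (simp add: dist_norm norm_minus_commute)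
  qed (use \<open>e > 0\<close> in simp)
  show "\<exists>d>0. \<forall>s\<in>{0..}. dist s t < d \<longrightarrow> dist (T s x) (T t x) < e"
  proof (intro exI[of _ "min b 1"] conjI ballI impI)
    fix s
    assume "s \<in> {0..}" "dist s t < min b 1"
    then show "dist (T s x) (T t x) < e"
      using increment[of s t] increment[of t s] \<open>t \<in> {0..}\<close>
      by (cases "s \<le> t") (auto simp: dist_real_def dist_commute)
  qed (use b(1) in auto)
qed

lemma C0_semigroup_convolution_continuous:
  assumes T: "C0_semigroup T" and f: "continuous_on {0..t} f"
  shows "continuous_on {0..t} (\<lambda>s. T (t - s) (f s))"
  unfolding continuous_on_def
proof
  fix s
  assume s: "s \<in> {0..t}"
  have lin: "\<And>t. t \<ge> 0 \<Longrightarrow> linear (T t)"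
    using T by (auto simp: C0_semigroup_def bounded_linear.linear)
  obtain M where M: "\<And>s x. 0 \<le> s \<Longrightarrow> s \<le> t \<Longrightarrow> norm (T s x) \<le> M * norm x"
    using C0_semigroup_locally_bounded[OF T] by metis
  have "continuous_on {0..t} (\<lambda>r. T (t - r) (f s))"
    by (rule continuous_on_compose2[OF C0_semigroup_continuous[OF T]]) (auto intro!: continuous_intros)
  then have orbit: "((\<lambda>r. T (t - r) (f s)) \<longlongrightarrow> T (t - s) (f s)) (at s within {0..t})"
    using s by (auto simp: continuous_on_def)
  have "((\<lambda>r. T (t - r) (f r - f s)) \<longlongrightarrow> 0) (at s within {0..t})"
  proof (rule Lim_null_comparison)
    show "\<forall>\<^sub>F r in at s within {0..t}. norm (T (t - r) (f r - f s)) \<le> M * norm (f r - f s)"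
      unfolding eventually_at_filter by (intro always_eventually) (use M in auto)
    have "(f \<longlongrightarrow> f s) (at s within {0..t})"
      using f s by (auto simp: continuous_on_def)
    then have "((\<lambda>r. M * norm (f r - f s)) \<longlongrightarrow> M * norm (f s - f s)) (at s within {0..t})"
      by (intro tendsto_intros)
    then show "((\<lambda>r. M * norm (f r - f s)) \<longlongrightarrow> 0) (at s within {0..t})"
      by simp
  qed
  from tendsto_add[OF this orbit]
  have "((\<lambda>r. T (t - r) (f r - f s) + T (t - r) (f s)) \<longlongrightarrow> T (t - s) (f s)) (at s within {0..t})"
    by simp
  moreover have "\<forall>\<^sub>F r in at s within {0..t}. T (t - r) (f r - f s) + T (t - r) (f s) = T (t - r) (f r)"
    unfolding eventually_at_filter by (intro always_eventually) (auto simp: linear_diff[OF lin])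
  ultimately show "((\<lambda>s. T (t - s) (f s)) \<longlongrightarrow> T (t - s) (f s)) (at s within {0..t})"
    by (rule Lim_transform_eventually)
qed

section \<open>Uniformly continuous semigroups\<close>

definition exp_op :: "('a::banach \<Rightarrow> 'a) \<Rightarrow> real \<Rightarrow> 'a \<Rightarrow> 'a"
  where "exp_op d t x = (\<Sum>n. (t ^ n / fact n) *\<^sub>R (d ^^ n) x)"

lemma norm_funpow_le:
  fixes d :: "'a::real_normed_vector \<Rightarrow> 'a"
  assumes "\<And>x. norm (d x) \<le> L * norm x" and "L \<ge> (0::real)"
  shows "norm ((d ^^ n) x) \<le> L ^ n * norm x"
proof (induction n)
  case (Suc n)
  have "norm (d ((d ^^ n) x)) \<le> L * norm ((d ^^ n) x)"
    by (rule assms(1))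
  also have "\<dots> \<le> L * (L ^ n * norm x)"
    by (rule mult_left_mono[OF Suc assms(2)])
  finally show ?case
    by (simp add: mult.assoc)
qed simp

lemma norm_exp_op_term_le:
  fixes d :: "'a::real_normed_vector \<Rightarrow> 'a"
  assumes "\<And>x. norm (d x) \<le> L * norm x" and "L \<ge> (0::real)"
  shows "norm ((t ^ n / fact n) *\<^sub>R (d ^^ n) x) \<le> (\<bar>t\<bar> * L) ^ n /\<^sub>R fact n * norm x"
proof -
  have "norm ((t ^ n / fact n) *\<^sub>R (d ^^ n) x) \<le> \<bar>t\<bar> ^ n / fact n * (L ^ n * norm x)"
    using mult_left_mono[OF norm_funpow_le[OF assms, of n x], of "\<bar>t\<bar> ^ n / fact n"]
    by (simp add: power_abs)
  then show ?thesis
    by (simp add: power_mult_distrib divide_inverse mult_ac)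
qed

lemma summable_norm_exp_op:
  fixes d :: "'a::real_normed_vector \<Rightarrow> 'a"
  assumes "\<And>x. norm (d x) \<le> L * norm x" and "L \<ge> (0::real)"
  shows "summable (\<lambda>n. norm ((t ^ n / fact n) *\<^sub>R (d ^^ n) x))"
  by (rule summable_comparison_test'[OF summable_mult2[OF summable_exp_generic[of "\<bar>t\<bar> * L"], of "norm x"], of 0])
    (use norm_exp_op_term_le[OF assms] in simp)

text \<open>
  The tail of the operator series is dominated by the tail of the scalar exponential series. The
  cases \<open>k = 0, 1, 2\<close> give boundedness, continuity at \<open>0\<close> and the derivative at \<open>0\<close>.
\<close>

lemma norm_exp_op_remainder_le:
  fixes d :: "'a::banach \<Rightarrow> 'a"
  assumes d: "\<And>x. norm (d x) \<le> L * norm x" "L \<ge> (0::real)"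
  shows "norm (exp_op d t x - (\<Sum>n<k. (t ^ n / fact n) *\<^sub>R (d ^^ n) x))
    \<le> (exp (\<bar>t\<bar> * L) - (\<Sum>n<k. (\<bar>t\<bar> * L) ^ n /\<^sub>R fact n)) * norm x"
proof -
  have summable: "summable (\<lambda>n. (t ^ n / fact n) *\<^sub>R (d ^^ n) x)"
    by (rule summable_norm_cancel[OF summable_norm_exp_op[OF d]])
  have "norm (exp_op d t x - (\<Sum>n<k. (t ^ n / fact n) *\<^sub>R (d ^^ n) x))
      = norm (\<Sum>n. (t ^ (n + k) / fact (n + k)) *\<^sub>R (d ^^ (n + k)) x)"
    using suminf_minus_initial_segment[OF summable, of k] by (simp add: exp_op_def)
  also have "\<dots> \<le> (\<Sum>n. (\<bar>t\<bar> * L) ^ (n + k) /\<^sub>R fact (n + k) * norm x)"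
    using norm_exp_op_term_le[OF d]
      summable_ignore_initial_segment[OF summable_mult2[OF summable_exp_generic[of "\<bar>t\<bar> * L"], of "norm x"]]
    by (intro norm_suminf_le) auto
  also have "\<dots> = (\<Sum>n. (\<bar>t\<bar> * L) ^ (n + k) /\<^sub>R fact (n + k)) * norm x"
    by (intro suminf_mult2[symmetric] summable_ignore_initial_segment summable_exp_generic)
  also have "(\<Sum>n. (\<bar>t\<bar> * L) ^ (n + k) /\<^sub>R fact (n + k)) =
      exp (\<bar>t\<bar> * L) - (\<Sum>n<k. (\<bar>t\<bar> * L) ^ n /\<^sub>R fact n)"
    unfolding exp_def by (rule suminf_minus_initial_segment[OF summable_exp_generic])
  finally show ?thesis .
qed

text \<open>
  Both sides sum the absolutely summable double family
  \<open>(s\<^sup>n/n!)(t\<^sup>m/m!) d\<^sup>n\<^sup>+\<^sup>mx\<close>: the right-hand side row by row, the left-hand side along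
  the diagonals \<open>n + m = k\<close>, by the binomial theorem.
\<close>

lemma exp_op_add:
  fixes d :: "'a::banach \<Rightarrow> 'a"
  assumes d: "linear d" "\<And>x. norm (d x) \<le> L * norm x" "L \<ge> (0::real)"
  shows "exp_op d (s + t) x = exp_op d s (exp_op d t x)"
proof -
  define f where "f = (\<lambda>(n, m). (s ^ n / fact n * (t ^ m / fact m)) *\<^sub>R (d ^^ (n + m)) x)"
  have lin: "linear (d ^^ n)" for n
  proof (induction n)
    case 0
    show ?case
      unfolding funpow.simps by (rule linear_id)
  next
    case (Suc n)
    then show ?case
      unfolding funpow.simps by (rule linear_compose[OF _ d(1)])
  qed
  have bl: "bounded_linear (d ^^ n)" for n
    using linear_add[OF lin] linear_scale[OF lin] norm_funpow_le[OF d(2,3)]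
    by (intro bounded_linear_intro[of _ "L ^ n"]) (simp_all add: mult.commute)
  have f_split: "f (n, m) = (s ^ n / fact n) *\<^sub>R (d ^^ n) ((t ^ m / fact m) *\<^sub>R (d ^^ m) x)" for n m
    by (simp add: f_def funpow_add linear_scale[OF lin])
  have norm_f: "norm (f (n, m)) \<le> ((\<bar>s\<bar> * L) ^ n /\<^sub>R fact n) * (((\<bar>t\<bar> * L) ^ m /\<^sub>R fact m) * norm x)" for n m
  proof -
    have "norm (f (n, m)) \<le> (\<bar>s\<bar> * L) ^ n /\<^sub>R fact n * norm ((t ^ m / fact m) *\<^sub>R (d ^^ m) x)"
      unfolding f_split by (rule norm_exp_op_term_le[OF d(2,3)])
    also have "\<dots> \<le> ((\<bar>s\<bar> * L) ^ n /\<^sub>R fact n) * (((\<bar>t\<bar> * L) ^ m /\<^sub>R fact m) * norm x)"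
      using \<open>L \<ge> 0\<close> by (intro mult_left_mono norm_exp_op_term_le[OF d(2,3)]) auto
    finally show ?thesis .
  qed
  have exp_summable: "(\<lambda>n. (r ^ n /\<^sub>R fact n :: real)) summable_on UNIV" for r
    using summable_norm_exp[of r] by (intro norm_summable_imp_summable_on) simp
  have "(\<lambda>(n, m). ((\<bar>s\<bar> * L) ^ n /\<^sub>R fact n) * (((\<bar>t\<bar> * L) ^ m /\<^sub>R fact m) * norm x)) summable_on UNIV \<times> UNIV"
  proof (rule summable_on_SigmaI)
    fix n :: nat
    show "((\<lambda>m. (case (n, m) of (n, m) \<Rightarrow> ((\<bar>s\<bar> * L) ^ n /\<^sub>R fact n) * (((\<bar>t\<bar> * L) ^ m /\<^sub>R fact m) * norm x))) has_sum
        ((\<bar>s\<bar> * L) ^ n /\<^sub>R fact n) * ((\<Sum>\<^sub>\<infinity>m. (\<bar>t\<bar> * L) ^ m /\<^sub>R fact m) * norm x)) UNIV"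
      unfolding case_prod_conv
      by (intro has_sum_cmult_right has_sum_cmult_left has_sum_infsum exp_summable)
    show "(\<lambda>n. ((\<bar>s\<bar> * L) ^ n /\<^sub>R fact n) * ((\<Sum>\<^sub>\<infinity>m. (\<bar>t\<bar> * L) ^ m /\<^sub>R fact m) * norm x)) summable_on UNIV"
      by (intro summable_on_cmult_left exp_summable)
  qed (use \<open>L \<ge> 0\<close> in auto)
  then have "(\<lambda>z. norm (f z)) summable_on UNIV \<times> UNIV"
    by (rule Infinite_Sum.abs_summable_on_comparison_test') (use norm_f in auto)
  then have "f summable_on UNIV \<times> UNIV"
    by (rule abs_summable_summable)
  then obtain S where S: "(f has_sum S) (UNIV \<times> UNIV)"
    by (auto simp: summable_on_def)
  have inner: "((\<lambda>m. f (n, m)) has_sum (s ^ n / fact n) *\<^sub>R (d ^^ n) (exp_op d t x)) UNIV" for n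
  proof -
    have "((\<lambda>m. (t ^ m / fact m) *\<^sub>R (d ^^ m) x) has_sum exp_op d t x) UNIV"
      unfolding exp_op_def
      by (intro norm_summable_imp_has_sum summable_sums summable_norm_cancel[OF summable_norm_exp_op[OF d(2,3)]]
          summable_norm_exp_op[OF d(2,3)])
    from has_sum_bounded_linear[OF bounded_linear_compose[OF bounded_linear_scaleR_right bl] this, of "s ^ n / fact n" n]
    show ?thesis
      by (simp add: f_split)
  qed
  have "((\<lambda>n. (s ^ n / fact n) *\<^sub>R (d ^^ n) (exp_op d t x)) has_sum S) UNIV"
    by (rule has_sum_SigmaD[OF S inner])
  then have 1: "S = exp_op d s (exp_op d t x)"
    unfolding exp_op_def[of d s] by (intro sums_unique has_sum_imp_sums)
  have reindexed: "((\<lambda>(k, n). f (n, k - n)) has_sum S) (SIGMA k:UNIV. {..k})"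
    using S
    by (subst has_sum_reindex_bij_witness[of _ "\<lambda>(n, m). (n + m, n)" "\<lambda>(k, n). (n, k - n)" "UNIV \<times> UNIV" f])
      auto
  have diagonal: "((\<lambda>n. f (n, k - n)) has_sum ((s + t) ^ k / fact k) *\<^sub>R (d ^^ k) x) {..k}" for k
  proof -
    have "(s + t) ^ k / fact k = (\<Sum>n\<le>k. s ^ n / fact n * (t ^ (k - n) / fact (k - n)))"
      using exp_series_add_commuting[of s t k] by (simp add: mult.commute divide_inverse mult_ac)
    then have "((s + t) ^ k / fact k) *\<^sub>R (d ^^ k) x = (\<Sum>n\<le>k. f (n, k - n))"
      by (simp add: f_def scaleR_sum_left)
    then show ?thesis
      by (simp add: has_sum_finite_iff)
  qed
  have "((\<lambda>k. ((s + t) ^ k / fact k) *\<^sub>R (d ^^ k) x) has_sum S) UNIV"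
    by (rule has_sum_SigmaD[OF reindexed]) (simp only: case_prod_conv diagonal)
  then have "S = exp_op d (s + t) x"
    unfolding exp_op_def[of d "s + t"] by (intro sums_unique has_sum_imp_sums)
  with 1 show ?thesis
    by simp
qed

lemma exp_op_first_order:
  fixes d :: "'a::banach \<Rightarrow> 'a"
  assumes "\<And>x. norm (d x) \<le> L * norm x" and "L \<ge> (0::real)"
  shows "norm (exp_op d t x) \<le> exp (\<bar>t\<bar> * L) * norm x"
    and "norm (exp_op d t x - x) \<le> (exp (\<bar>t\<bar> * L) - 1) * norm x"
    and "norm (exp_op d t x - x - t *\<^sub>R d x) \<le> (exp (\<bar>t\<bar> * L) - 1 - \<bar>t\<bar> * L) * norm x"
proof -
  show "norm (exp_op d t x) \<le> exp (\<bar>t\<bar> * L) * norm x"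
    using norm_exp_op_remainder_le[OF assms, of t x 0] by simp
  show "norm (exp_op d t x - x) \<le> (exp (\<bar>t\<bar> * L) - 1) * norm x"
    using norm_exp_op_remainder_le[OF assms, of t x "Suc 0"] by simp
  have "(\<Sum>n<Suc (Suc 0). (t ^ n / fact n) *\<^sub>R (d ^^ n) x) = x + t *\<^sub>R d x"
    and "(\<Sum>n<Suc (Suc 0). (\<bar>t\<bar> * L) ^ n /\<^sub>R fact n) = 1 + \<bar>t\<bar> * L"
    by simp_all
  then show "norm (exp_op d t x - x - t *\<^sub>R d x) \<le> (exp (\<bar>t\<bar> * L) - 1 - \<bar>t\<bar> * L) * norm x"
    using norm_exp_op_remainder_le[OF assms, of t x "Suc (Suc 0)"] by (metis diff_diff_eq)
qed

lemma exp_op_derivative_zero: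
  fixes d :: "'a::banach \<Rightarrow> 'a"
  assumes d: "\<And>x. norm (d x) \<le> L * norm x" "L \<ge> (0::real)"
  shows "((\<lambda>t. (exp_op d t x - x) /\<^sub>R t) \<longlongrightarrow> d x) (at_right 0)"
proof (rule LIM_zero_cancel, rule Lim_null_comparison)
  have "((\<lambda>t. exp (t * L)) has_real_derivative L) (at 0)"
    by (auto intro!: derivative_eq_intros)
  then have "((\<lambda>t. (exp (t * L) - 1) / t) \<longlongrightarrow> L) (at_right 0)"
    by (simp add: has_field_derivative_iff filterlim_at_split)
  then have "((\<lambda>t. ((exp (t * L) - 1) / t - L) * norm x) \<longlongrightarrow> (L - L) * norm x) (at_right 0)"
    by (intro tendsto_intros)
  then show "((\<lambda>t. ((exp (t * L) - 1) / t - L) * norm x) \<longlongrightarrow> 0) (at_right 0)"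
    by simp
  show "\<forall>\<^sub>F t in at_right 0. norm ((exp_op d t x - x) /\<^sub>R t - d x) \<le> ((exp (t * L) - 1) / t - L) * norm x"
    using eventually_at_right_less[of 0]
  proof eventually_elim
    case (elim t)
    have "(exp_op d t x - x) /\<^sub>R t - d x = (exp_op d t x - x - t *\<^sub>R d x) /\<^sub>R t"
      using elim by (simp add: scaleR_diff_right)
    then have "norm ((exp_op d t x - x) /\<^sub>R t - d x) = norm (exp_op d t x - x - t *\<^sub>R d x) / t"
      using elim by (simp add: divide_inverse mult.commute)
    also have "\<dots> \<le> (exp (t * L) - 1 - t * L) * norm x / t"
      using exp_op_first_order(3)[OF d, of t x] elim by (intro divide_right_mono) auto
    also have "\<dots> = ((exp (t * L) - 1) / t - L) * norm x"
      using elim by (simp add: field_simps)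
    finally show ?case .
  qed
qed

lemma C0_semigroup_exp_op:
  fixes d :: "'a::complex_hilbert_space \<Rightarrow> 'a"
  assumes clin: "clinear d" and d: "\<And>x. norm (d x) \<le> L * norm x" "L \<ge> (0::real)"
  shows "C0_semigroup (exp_op d)"
proof -
  have summable: "summable (\<lambda>n. (t ^ n / fact n) *\<^sub>R (d ^^ n) x)" for t x
    by (rule summable_norm_cancel[OF summable_norm_exp_op[OF d]])
  have pow: "(d ^^ n) (x + y) = (d ^^ n) x + (d ^^ n) y" "(d ^^ n) (a *\<^sub>C x) = a *\<^sub>C (d ^^ n) x" for n x y a
    using clin by (induction n) (simp_all add: clinear_iff)
  have "exp_op d t (x + y) = exp_op d t x + exp_op d t y" for t x y
    by (simp add: exp_op_def pow scaleR_add_right suminf_add[OF summable summable])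
  moreover have "exp_op d t (a *\<^sub>C x) = a *\<^sub>C exp_op d t x" for t a x
    by (simp add: exp_op_def pow scaleC_scaleR_commute[symmetric]
        bounded_linear.suminf[OF bounded_linear_scaleC summable])
  ultimately have lin: "clinear (exp_op d t)" for t
    by (simp add: clinear_iff)
  have bl: "bounded_linear (exp_op d t)" for t
    using linear_add[OF clinear_imp_linear[OF lin]] linear_scale[OF clinear_imp_linear[OF lin]]
      exp_op_first_order(1)[OF d]
    by (intro bounded_linear_intro[of _ "exp (\<bar>t\<bar> * L)"]) (simp_all add: mult.commute)
  have zero: "exp_op d 0 = id"
    using exp_op_first_order(2)[OF d, of 0] by (simp add: fun_eq_iff)
  have law: "exp_op d (s + t) = exp_op d s \<circ> exp_op d t" for s t
    using exp_op_add[OF clinear_imp_linear[OF clin] d] by (simp add: fun_eq_iff)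
  have "((\<lambda>t. exp_op d t x) \<longlongrightarrow> x) (at_right 0)" for x
  proof (rule LIM_zero_cancel, rule Lim_null_comparison)
    have "((\<lambda>t. (exp (\<bar>t\<bar> * L) - 1) * norm x) \<longlongrightarrow> (exp (\<bar>0\<bar> * L) - 1) * norm x) (at_right 0)"
      by (intro tendsto_intros)
    then show "((\<lambda>t. (exp (\<bar>t\<bar> * L) - 1) * norm x) \<longlongrightarrow> 0) (at_right 0)"
      by simp
  qed (use exp_op_first_order(2)[OF d] in \<open>simp add: always_eventually\<close>)
  with lin bl zero law show ?thesis
    by (simp add: C0_semigroup_def)
qed

section \<open>Triangular perturbation of a generator\<close>

text \<open>
  The upper right entry of the semigroup given by variation of constants.
\<close>

definition convolution_op :: "(real \<Rightarrow> 'a::banach \<Rightarrow> 'a) \<Rightarrow> ('b \<Rightarrow> 'a) \<Rightarrow> (real \<Rightarrow> 'b \<Rightarrow> 'b) \<Rightarrow>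
    real \<Rightarrow> 'b \<Rightarrow> 'a"
  where "convolution_op S q E t x = integral {0..t} (\<lambda>s. S (t - s) (q (E s x)))"

lemma convolution_op_integrand_continuous:
  assumes "C0_semigroup S" and "C0_semigroup E" and q: "bounded_linear q"
  shows "continuous_on {0..t} (\<lambda>s. S (t - s) (q (E s x)))"
  using assms(1)
proof (rule C0_semigroup_convolution_continuous)
  have "continuous_on {0..t} (\<lambda>s. E s x)"
    by (rule continuous_on_subset[OF C0_semigroup_continuous[OF assms(2)]]) auto
  then show "continuous_on {0..t} (\<lambda>s. q (E s x))"
    by (rule bounded_linear.continuous_on[OF q])
qed

lemma convolution_op_linear:
  fixes q :: "'b::complex_hilbert_space \<Rightarrow> 'a::complex_hilbert_space"
  assumes S: "C0_semigroup S" and E: "C0_semigroup E" and q: "bounded_linear q" "clinear q" and "t \<ge> 0"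
  shows "clinear (convolution_op S q E t)" and "bounded_linear (convolution_op S q E t)"
proof -
  have linS: "clinear (S s)" and linE: "clinear (E s)" if "s \<ge> 0" for s
    using S E that by (simp_all add: C0_semigroup_def)
  note integrable = integrable_continuous_real[OF convolution_op_integrand_continuous[OF S E q(1)]]
  have add: "convolution_op S q E t (x + y) = convolution_op S q E t x + convolution_op S q E t y" for x y
  proof -
    have "convolution_op S q E t (x + y) = integral {0..t} (\<lambda>s. S (t - s) (q (E s x)) + S (t - s) (q (E s y)))"
      unfolding convolution_op_def
      by (rule integral_cong) (use linS linE q(2) in \<open>simp add: clinear_iff\<close>)
    then show ?thesis
      by (simp add: convolution_op_def integral_add[OF integrable integrable])
  qed
  have scale: "convolution_op S q E t (a *\<^sub>C x) = a *\<^sub>C convolution_op S q E t x" for a x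
  proof -
    have "convolution_op S q E t (a *\<^sub>C x) = integral {0..t} ((\<lambda>y. a *\<^sub>C y) \<circ> (\<lambda>s. S (t - s) (q (E s x))))"
      unfolding convolution_op_def
      by (rule integral_cong) (use linS linE q(2) in \<open>simp add: clinear_iff\<close>)
    then show ?thesis
      by (simp add: convolution_op_def integral_linear[OF integrable bounded_linear_scaleC])
  qed
  show lin: "clinear (convolution_op S q E t)"
    using add scale by (simp add: clinear_iff)
  obtain M where M: "M > 0" "\<And>s x. 0 \<le> s \<Longrightarrow> s \<le> t \<Longrightarrow> norm (S s x) \<le> M * norm x"
    using C0_semigroup_locally_bounded[OF S] by blast
  obtain N where N: "N > 0" "\<And>s x. 0 \<le> s \<Longrightarrow> s \<le> t \<Longrightarrow> norm (E s x) \<le> N * norm x"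
    using C0_semigroup_locally_bounded[OF E] by blast
  obtain L where L: "L > 0" "\<And>x. norm (q x) \<le> L * norm x"
    using bounded_linear.pos_bounded[OF q(1)] by (metis mult.commute)
  have "norm (convolution_op S q E t x) \<le> M * (L * (N * norm x)) * (t - 0)" for x
    unfolding convolution_op_def using \<open>t \<ge> 0\<close> convolution_op_integrand_continuous[OF S E q(1)]
  proof (rule integral_bound)
    fix s
    assume s: "s \<in> {0..t}"
    then have "norm (S (t - s) (q (E s x))) \<le> M * norm (q (E s x))"
      by (intro M) auto
    also have "\<dots> \<le> M * (L * norm (E s x))"
      using L M(1) by (intro mult_left_mono) auto
    also have "\<dots> \<le> M * (L * (N * norm x))"
      using s L(1) M(1) N(2) by (intro mult_left_mono) auto
    finally show "norm (S (t - s) (q (E s x))) \<le> M * (L * (N * norm x))" .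
  qed
  then show "bounded_linear (convolution_op S q E t)"
    using linear_add[OF clinear_imp_linear[OF lin]] linear_scale[OF clinear_imp_linear[OF lin]]
    by (intro bounded_linear_intro[of _ "M * L * N * t"]) (simp_all add: mult_ac)
qed

text \<open>
  Split the integral over \<open>[0, s + t]\<close> at \<open>t\<close>. On the first part \<open>S(s + t - r) = S(s)S(t - r)\<close>; on the
  second, substitute \<open>r = t + r'\<close> and use \<open>E(t + r') = E(r')E(t)\<close>. This is the identity that makes
  the triangular family a semigroup.
\<close>

lemma convolution_op_add:
  fixes q :: "'b::complex_hilbert_space \<Rightarrow> 'a::complex_hilbert_space"
  assumes S: "C0_semigroup S" and E: "C0_semigroup E" and q: "bounded_linear q" and "s \<ge> 0" and "t \<ge> 0"
  shows "convolution_op S q E (s + t) x = S s (convolution_op S q E t x) + convolution_op S q E s (E t x)"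
proof -
  have lawS: "\<And>r r' y. r \<ge> 0 \<Longrightarrow> r' \<ge> 0 \<Longrightarrow> S (r + r') y = S r (S r' y)"
    and lawE: "\<And>r r' y. r \<ge> 0 \<Longrightarrow> r' \<ge> 0 \<Longrightarrow> E (r + r') y = E r (E r' y)"
    and bl: "bounded_linear (S s)"
    using S E \<open>s \<ge> 0\<close> by (simp_all add: C0_semigroup_def)
  define g where "g = (\<lambda>r. S (s + t - r) (q (E r x)))"
  have g: "g integrable_on {0..s + t}"
    unfolding g_def by (rule integrable_continuous_real[OF convolution_op_integrand_continuous[OF S E q]])
  have "integral {0..t} g = integral {0..t} (S s \<circ> (\<lambda>r. S (t - r) (q (E r x))))"
    using lawS[of s] \<open>s \<ge> 0\<close> by (intro integral_cong) (simp add: g_def add_diff_eq[symmetric])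
  also have "\<dots> = S s (convolution_op S q E t x)"
    unfolding convolution_op_def
    by (rule integral_linear[OF integrable_continuous_real[OF convolution_op_integrand_continuous[OF S E q]] bl])
  finally have first: "integral {0..t} g = S s (convolution_op S q E t x)" .
  have "integral {t..s + t} g = integral {0..s} (g \<circ> (+) t)"
    using integral_shift_Icc_real[of 0 s g t] by simp
  also have "\<dots> = convolution_op S q E s (E t x)"
    unfolding convolution_op_def
  proof (rule integral_cong)
    fix r
    assume "r \<in> {0..s}"
    then show "(g \<circ> (+) t) r = S (s - r) (q (E r (E t x)))"
      using lawE[of r t x] \<open>t \<ge> 0\<close> by (simp add: g_def add.commute)
  qed
  finally have second: "integral {t..s + t} g = convolution_op S q E s (E t x)" .
  have "convolution_op S q E (s + t) x = integral {0..s + t} g"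
    by (simp add: convolution_op_def g_def)
  also have "\<dots> = integral {0..t} g + integral {t..s + t} g"
    using Henstock_Kurzweil_Integration.integral_combine[OF \<open>t \<ge> 0\<close> _ g] \<open>s \<ge> 0\<close> by simp
  finally show ?thesis
    by (simp add: first second)
qed

text \<open>
  The integrand \<open>S(t - s)qE(s)x\<close> is uniformly close to \<open>qx\<close> for \<open>0 \<le> s \<le> t\<close> when \<open>t\<close> is small, because
  \<open>S\<close> is bounded near \<open>0\<close>; hence so is its mean value.
\<close>

lemma convolution_op_derivative_zero:
  fixes q :: "'b::complex_hilbert_space \<Rightarrow> 'a::complex_hilbert_space"
  assumes S: "C0_semigroup S" and E: "C0_semigroup E" and q: "bounded_linear q"
  shows "((\<lambda>t. convolution_op S q E t x /\<^sub>R t) \<longlongrightarrow> q x) (at_right 0)"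
proof (rule tendstoI)
  fix e :: real
  assume "e > 0"
  have linS: "\<And>s. s \<ge> 0 \<Longrightarrow> linear (S s)" and S0: "S 0 = id" and E0: "E 0 = id"
    and limS: "((\<lambda>t. S t (q x)) \<longlongrightarrow> q x) (at_right 0)" and limE: "((\<lambda>t. E t x) \<longlongrightarrow> x) (at_right 0)"
    using S E by (auto simp: C0_semigroup_def bounded_linear.linear)
  obtain M where M: "M > 0" "\<And>s x. 0 \<le> s \<Longrightarrow> s \<le> 1 \<Longrightarrow> norm (S s x) \<le> M * norm x"
    using C0_semigroup_locally_bounded[OF S] by blast
  have "\<forall>\<^sub>F s in at_right 0. dist (S s (q x)) (q x) < e / 4"
    using limS \<open>e > 0\<close> by (intro tendstoD) auto
  moreover have "\<forall>\<^sub>F s in at_right 0. dist (q (E s x)) (q x) < e / (4 * M)"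
    using bounded_linear.tendsto[OF q limE] \<open>e > 0\<close> M(1) by (intro tendstoD) auto
  ultimately have "\<forall>\<^sub>F s in at_right 0. dist (S s (q x)) (q x) < e / 4 \<and> dist (q (E s x)) (q x) < e / (4 * M)"
    by (rule eventually_conj)
  then obtain b where b: "b > 0"
    "\<And>s. 0 < s \<Longrightarrow> s < b \<Longrightarrow> dist (S s (q x)) (q x) < e / 4 \<and> dist (q (E s x)) (q x) < e / (4 * M)"
    by (auto simp: eventually_at_right[of 0 1])
  have near: "norm (S s (q x) - q x) \<le> e / 4" "norm (q (E s x) - q x) \<le> e / (4 * M)" if "0 \<le> s" "s < b" for s
    using b(2)[of s] that \<open>e > 0\<close> M(1) by (cases "s = 0"; simp add: S0 E0 dist_norm less_imp_le)+
  have "dist (convolution_op S q E t x /\<^sub>R t) (q x) < e" if t: "0 < t" "t < min b 1" for t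
  proof -
    let ?g = "\<lambda>s. S (t - s) (q (E s x))"
    have cont: "continuous_on {0..t} ?g"
      by (rule convolution_op_integrand_continuous[OF S E q])
    have "norm (integral {0..t} (\<lambda>s. ?g s - q x)) \<le> e / 2 * (t - 0)"
    proof (rule integral_bound)
      show "continuous_on {0..t} (\<lambda>s. ?g s - q x)"
        by (intro continuous_intros cont)
      fix s
      assume s: "s \<in> {0..t}"
      have "?g s - q x = S (t - s) (q (E s x) - q x) + (S (t - s) (q x) - q x)"
        using s by (simp add: linear_diff[OF linS])
      then have "norm (?g s - q x) \<le> norm (S (t - s) (q (E s x) - q x)) + norm (S (t - s) (q x) - q x)"
        by (metis norm_triangle_ineq)
      also have "\<dots> \<le> M * (e / (4 * M)) + e / 4"
      proof (rule add_mono)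
        have "norm (S (t - s) (q (E s x) - q x)) \<le> M * norm (q (E s x) - q x)"
          using s t by (intro M) auto
        also have "\<dots> \<le> M * (e / (4 * M))"
          using s t M(1) by (intro mult_left_mono near) auto
        finally show "norm (S (t - s) (q (E s x) - q x)) \<le> M * (e / (4 * M))" .
        show "norm (S (t - s) (q x) - q x) \<le> e / 4"
          using s t by (intro near) auto
      qed
      also have "\<dots> = e / 2"
        using M(1) by (simp add: field_simps)
      finally show "norm (?g s - q x) \<le> e / 2" .
    qed (use t in auto)
    moreover have "integral {0..t} (\<lambda>s. ?g s - q x) = convolution_op S q E t x - t *\<^sub>R q x"
      using t by (simp add: integral_diff[OF integrable_continuous_real[OF cont] integrable_const_ivl] convolution_op_def)
    ultimately have "norm (convolution_op S q E t x - t *\<^sub>R q x) / t \<le> e / 2"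
      using t by (simp add: pos_divide_le_eq)
    moreover have "convolution_op S q E t x /\<^sub>R t - q x = (convolution_op S q E t x - t *\<^sub>R q x) /\<^sub>R t"
      using t by (simp add: scaleR_diff_right)
    then have "dist (convolution_op S q E t x /\<^sub>R t) (q x) = norm (convolution_op S q E t x - t *\<^sub>R q x) / t"
      using t by (simp add: dist_norm divide_inverse mult.commute)
    ultimately have "dist (convolution_op S q E t x /\<^sub>R t) (q x) \<le> e / 2"
      by simp
    then show ?thesis
      using \<open>e > 0\<close> by simp
  qed
  then show "\<forall>\<^sub>F t in at_right 0. dist (convolution_op S q E t x /\<^sub>R t) (q x) < e"
    using b(1) unfolding eventually_at_right[of 0 1, OF zero_less_one] by (intro exI[of _ "min b 1"]) auto
qed

text \<open>
  In the difference quotient at \<open>(x\<^sub>1, x\<^sub>2)\<close> the terms that involve \<open>x\<^sub>2\<close> always converge, to \<open>qx\<^sub>2\<close>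
  and \<open>dx\<^sub>2\<close>. So the quotient converges if and only if that of \<open>S\<close> converges at \<open>x\<^sub>1\<close>, which identifies the
  generator together with its domain.
\<close>

lemma generates_C0_semigroup_triangular_op:
  fixes q :: "'b::complex_hilbert_space \<Rightarrow> 'a::complex_hilbert_space"
  assumes A: "generates_C0_semigroup A" and q: "clinear q" "bounded_linear q"
    and d: "clinear d" "bounded_linear d"
  shows "generates_C0_semigroup (triangular_op A q d)"
proof -
  obtain S where S: "C0_semigroup S" "semigroup_generator S = A"
    using A by (auto simp: generates_C0_semigroup_def)
  obtain L where L: "L \<ge> 0" "\<And>x. norm (d x) \<le> L * norm x"
    using bounded_linear.nonneg_bounded[OF d(2)] by (metis mult.commute)
  define E where "E = exp_op d"
  have E: "C0_semigroup E"
    unfolding E_def by (rule C0_semigroup_exp_op[OF d(1) L(2,1)])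
  define R where "R = convolution_op S q E"
  have R0: "R 0 x = 0" for x
    by (simp add: R_def convolution_op_def)
  have R': "((\<lambda>t. R t x /\<^sub>R t) \<longlongrightarrow> q x) (at_right 0)" for x
    unfolding R_def by (rule convolution_op_derivative_zero[OF S(1) E q(2)])
  have E': "((\<lambda>t. (E t x - x) /\<^sub>R t) \<longlongrightarrow> d x) (at_right 0)" for x
    unfolding E_def by (rule exp_op_derivative_zero[OF L(2,1)])
  define T where "T t z = (S t (fst z) + R t (snd z), E t (snd z))" for t and z :: "'a \<times> 'b"
  have "C0_semigroup T"
    unfolding C0_semigroup_def
  proof (intro conjI allI impI)
    fix t :: real
    assume "t \<ge> 0"
    then have lin: "clinear (S t)" "bounded_linear (S t)" "clinear (E t)" "bounded_linear (E t)"
      "clinear (R t)" "bounded_linear (R t)"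
      using S(1) E convolution_op_linear[OF S(1) E q(2,1)] by (simp_all add: C0_semigroup_def R_def)
    then show "clinear (T t)"
      by (simp add: clinear_iff T_def scaleC_prod_def scaleC_add_right)
    show "bounded_linear (T t)"
      unfolding T_def
      by (intro bounded_linear_Pair bounded_linear_add bounded_linear_compose[OF lin(2)]
          bounded_linear_compose[OF lin(4)] bounded_linear_compose[OF lin(6)]
          bounded_linear_fst bounded_linear_snd)
  next
    show "T 0 = id"
      using S(1) E by (simp add: fun_eq_iff T_def R0 C0_semigroup_def)
  next
    fix s t :: real
    assume st: "s \<ge> 0" "t \<ge> 0"
    have "linear (S s)"
      using S(1) st by (simp add: C0_semigroup_def bounded_linear.linear)
    then show "T (s + t) = T s \<circ> T t"
      using S(1) E st convolution_op_add[OF S(1) E q(2) st]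
      by (simp add: fun_eq_iff T_def R_def C0_semigroup_def linear_add)
  next
    fix z :: "'a \<times> 'b"
    have "((\<lambda>t. t *\<^sub>R (R t (snd z) /\<^sub>R t)) \<longlongrightarrow> 0 *\<^sub>R q (snd z)) (at_right 0)"
      by (intro tendsto_intros R')
    moreover have "\<forall>\<^sub>F t in at_right 0. t *\<^sub>R (R t (snd z) /\<^sub>R t) = R t (snd z)"
      using eventually_at_right_less[of 0] by eventually_elim simp
    ultimately have "((\<lambda>t. R t (snd z)) \<longlongrightarrow> 0) (at_right 0)"
      by (simp add: Lim_transform_eventually)
    moreover have "((\<lambda>t. S t (fst z)) \<longlongrightarrow> fst z) (at_right 0)" "((\<lambda>t. E t (snd z)) \<longlongrightarrow> snd z) (at_right 0)"
      using S(1) E by (simp_all add: C0_semigroup_def)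
    ultimately have "((\<lambda>t. T t z) \<longlongrightarrow> (fst z + 0, snd z)) (at_right 0)"
      unfolding T_def by (intro tendsto_intros)
    then show "((\<lambda>t. T t z) \<longlongrightarrow> z) (at_right 0)"
      by simp
  qed
  moreover have "semigroup_generator T = triangular_op A q d"
  proof
    fix z
    have quotient: "(\<lambda>t. (T t z - z) /\<^sub>R t) =
        (\<lambda>t. ((S t (fst z) - fst z) /\<^sub>R t + R t (snd z) /\<^sub>R t, (E t (snd z) - snd z) /\<^sub>R t))"
      by (simp add: fun_eq_iff T_def prod_eq_iff scaleR_add_right scaleR_diff_right)
    have "semigroup_generator T z = Some y \<longleftrightarrow> triangular_op A q d z = Some y" for y
    proof
      assume "semigroup_generator T z = Some y"
      then have y: "((\<lambda>t. (T t z - z) /\<^sub>R t) \<longlongrightarrow> y) (at_right 0)"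
        by (simp add: semigroup_generator_eq_Some_iff)
      note y = y[unfolded quotient]
      from tendsto_diff[OF tendsto_fst[OF y] R'[of "snd z"]]
      have "((\<lambda>t. (S t (fst z) - fst z) /\<^sub>R t) \<longlongrightarrow> fst y - q (snd z)) (at_right 0)"
        by simp
      then have "A (fst z) = Some (fst y - q (snd z))"
        by (simp add: semigroup_generator_eq_Some_iff flip: S(2))
      moreover have "snd y = d (snd z)"
        by (rule tendsto_unique[OF trivial_limit_at_right_real _ E']) (use tendsto_snd[OF y] in simp)
      ultimately show "triangular_op A q d z = Some y"
        by (auto simp: triangular_op_def dom_def prod_eq_iff split: prod.splits)
    next
      assume z: "triangular_op A q d z = Some y"
      then have "fst z \<in> dom A" and y: "y = (A \<cdot> fst z + q (snd z), d (snd z))"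
        by (auto simp: triangular_op_def split: prod.splits if_splits)
      then have "semigroup_generator S (fst z) = Some (A \<cdot> fst z)"
        by (simp add: S(2) dom_iff_apply)
      then have "((\<lambda>t. (S t (fst z) - fst z) /\<^sub>R t) \<longlongrightarrow> A \<cdot> fst z) (at_right 0)"
        by (simp only: semigroup_generator_eq_Some_iff)
      then have "((\<lambda>t. (T t z - z) /\<^sub>R t) \<longlongrightarrow> y) (at_right 0)"
        unfolding quotient y by (intro tendsto_intros R' E')
      then show "semigroup_generator T z = Some y"
        by (simp add: semigroup_generator_eq_Some_iff)
    qed
    then show "semigroup_generator T z = triangular_op A q d z"
      by (metis option.exhaust)
  qed
  ultimately show ?thesis
    by (auto simp: generates_C0_semigroup_def)
qed

section \<open>The invertible outer extension\<close>

theorem proposition6p1: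
  fixes A U P :: "'a::complex_hilbert_space \<rightharpoonup> 'a"
    and c :: real
    and B :: "'a \<times> 'a \<rightharpoonup> 'a \<times> 'a"
  assumes "is_operator A" and "closed_op A" and "densely_defined A"
    and "c > 0" and "\<forall>x\<in>dom A. norm (A \<cdot> x) \<ge> c * norm x"
    and "polar_decomposition A U P"
    and "B = block_extension c A U"
  shows "outer_extension (\<lambda>x. (x, 0)) B A \<and>
    (invertible_op B \<and> op_norm (op_inverse B) \<le> inverse c) \<and>
    (\<not> invertible_op A \<longrightarrow> op_spectrum B \<subseteq> op_spectrum A) \<and>
    (generates_C0_semigroup A \<longrightarrow> generates_C0_semigroup B) \<and>
    (bounded_op A \<longrightarrow> bounded_op B \<and> op_norm B = op_norm A)"
proof -
  have below: "c * norm x \<le> norm (A \<cdot> x)" if "x \<in> dom A" for x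
    using assms(5) that by blast
  note U = polar_decomposition_isometry[OF assms(1,2,4) below assms(6)]
  have "closed (ran U)"
    using closed_ran_if_bounded_below[OF assms(1,2,4) below] U(4) by simp
  note V = isometry_adjoint[OF U(1-3) this]
  define u where "u x = U \<cdot> x" for x
  define v where "v x = adj U \<cdot> x" for x
  define q where "q x = c *\<^sub>R (x - u (v x))" for x
  define d where "d x = c *\<^sub>R v x" for x
  have lin: "clinear u" "clinear v"
    using U(2) V(2) by (simp_all add: u_def[abs_def] v_def[abs_def])
  have vu: "v (u x) = x" for x
    using V(4) by (simp add: u_def v_def)
  have add: "u (x + y) = u x + u y" "v (x + y) = v x + v y"
    and scale: "u (a *\<^sub>C x) = a *\<^sub>C u x" "v (a *\<^sub>C x) = a *\<^sub>C v x" for x y a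
    using lin by (simp_all add: clinear_iff)
  have scaleR: "u (r *\<^sub>R x) = r *\<^sub>R u x" "v (r *\<^sub>R x) = r *\<^sub>R v x"
    and diff: "v (x - y) = v x - v y" for r x y
    using lin[THEN clinear_imp_linear] by (simp_all add: linear_scale linear_diff)
  have uv: "(U \<circ>\<^sub>m adj U) \<cdot> x = u (v x)" for x
  proof -
    have "adj U x = Some (v x)"
      using V(1) by (simp add: v_def flip: dom_iff_apply)
    then show ?thesis
      by (simp add: u_def)
  qed
  have B: "B = triangular_op A q d"
    by (rule ext) (simp add: assms(7) block_extension_def triangular_op_def q_def d_def uv v_def split: prod.splits)
  have q: "clinear q" and d: "clinear d"
    by (simp_all add: clinear_iff q_def d_def add scale scaleR_add_right[symmetric]
        scaleC_scaleR_commute scaleC_diff_right add_diff_add)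
  have norms: "(norm (q x))\<^sup>2 + (norm (d x))\<^sup>2 = (c * norm x)\<^sup>2" for x
    using V(5)[of x] by (simp add: q_def d_def u_def v_def power_mult_distrib distrib_left)
  have d_le: "norm (d x) \<le> c * norm x" and q_le: "norm (q x) \<le> c * norm x" for x
  proof -
    have "(norm (d x))\<^sup>2 \<le> (c * norm x)\<^sup>2" "(norm (q x))\<^sup>2 \<le> (c * norm x)\<^sup>2"
      unfolding norms[symmetric] by simp_all
    then show "norm (d x) \<le> c * norm x" "norm (q x) \<le> c * norm x"
      using assms(4) by (auto intro: power2_le_imp_le)
  qed
  have bl: "bounded_linear q" "bounded_linear d"
    using q[THEN clinear_imp_linear] d[THEN clinear_imp_linear] q_le d_le
    by (auto intro!: bounded_linear_intro[of _ c] simp: linear_add linear_scale mult.commute)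
  have ortho: "inner (A \<cdot> x) (q y) = 0" if "x \<in> dom A" for x y
  proof -
    have "A \<cdot> x \<in> ran U"
      using that by (auto simp: U(4) mem_ran_iff)
    then obtain w where "A \<cdot> x = u w"
      by (auto simp: mem_ran_iff u_def)
    moreover have "cinner (u w) (y - u (v y)) = 0"
      using V(3)[of w "y - u (v y)"] by (simp add: diff vu cinner_diff_right cinner_zero_right flip: u_def v_def)
    then have "inner (u w) (y - u (v y)) = 0"
      by (metis Re_cinner zero_complex.sel(1))
    ultimately show ?thesis
      by (simp add: q_def)
  qed
  have surj: "\<exists>x\<^sub>2. d x\<^sub>2 = y\<^sub>2 \<and> y\<^sub>1 - q x\<^sub>2 \<in> ran A" for y\<^sub>1 y\<^sub>2
  proof (intro exI conjI)
    \<comment> \<open>\<open>cU\<^sup>*\<close> sees only the part \<open>u y\<^sub>2\<close> in \<open>Ran A\<close>, and \<open>c(I - UU\<^sup>*)\<close> only the part orthogonal to it\<close>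
    let ?x = "inverse c *\<^sub>R (y\<^sub>1 - u (v y\<^sub>1) + u y\<^sub>2)"
    have v: "v ?x = inverse c *\<^sub>R y\<^sub>2"
      by (simp add: scaleR add diff vu)
    show "d ?x = y\<^sub>2"
      using assms(4) by (simp add: d_def v)
    have "q ?x = y\<^sub>1 - u (v y\<^sub>1)"
      unfolding q_def v using assms(4) by (simp add: scaleR scaleR_diff_right)
    moreover have "u (v y\<^sub>1) \<in> ran U"
      by (auto simp: mem_ran_iff U(1) u_def)
    ultimately show "y\<^sub>1 - q ?x \<in> ran A"
      by (simp add: U(4))
  qed
  show ?thesis
    unfolding B
    using outer_extension_triangular_op[OF assms(1) q d]
      invertible_completed_triangular_op[OF assms(1) q d assms(4) below norms ortho surj]
      op_spectrum_triangular_op_subset[OF assms(1,2,4) below _ q bl(1) d d_le]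
      generates_C0_semigroup_triangular_op[OF _ q bl(1) d bl(2)]
      op_norm_completed_triangular_op[OF assms(1) q d assms(4,3) _ below norms ortho]
    by blast
qed

end
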